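(* Let $H$ be an infinite-dimensional separable complex Hilbert space, let $T\in\mathcal{B}(H)$ be a normal operator, and put $\Lambda:=\sigma_p(|T|)\subseteq[0,\|T\|]$. Then the following are equivalent: (i) $T\in\mathcal{M}_r(H)$; (ii) $\Lambda$ is countable and well-ordered by the usual order of $\mathbb{R}$, and there exist pairwise orthogonal closed subspaces $(H_a)_{a\in\Lambda}$ of $H$, each reducing $T$, and unitary operators $U_a\in\mathcal{B}(H_a)$ $(a\in\Lambda)$ such that $$H=\bigoplus_{a\in\Lambda}H_a\quad\text{and}\quad T=\bigoplus_{a\in\Lambda}a\,U_a.$$
   Context: $\mathcal{B}(H)$ denotes the bounded linear operators on $H$; $|T|=(T^*T)^{1/2}$; $\sigma_p(A)$ is the set of eigenvalues of $A$. For a nonzero Hilbert space $M$ and $A\in\mathcal{B}(M)$, the minimum modulus is $m(A)=\inf\{\|Ax\|: x\in M,\ \|x\|=1\}$; $A$ is minimum attaining if there is a unit vector $x_0\in M$ with $\|Ax_0\|=m(A)$. A closed subspace $M\subseteq H$ reduces $T\in\mathcal{B}(H)$ if $T(M)\subseteq M$ and $T^*(M)\subseteq M$. $\mathcal{M}_r(H)$ is the set of all $T\in\mathcal{B}(H)$ such that for every nonzero closed subspace $M$ reducing $T$, the restriction $T|_M:M\to M$ is minimum attaining. Direct sums are Hilbert space orthogonal direct sums; $T=\bigoplus_a aU_a$ means $T|_{H_a}=aU_a$ for each $a$. *)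

theory Defs
  imports "HOL-Analysis.Analysis"
begin

(* The real vector space and norm structure is inherited, so that the topological notions of the
   library apply; the inner product is linear in its first argument.  The axiom cinner_self
   expresses at once positive definiteness and that the norm is the one induced by cinner. *)
class complex_inner = real_normed_vector +
  fixes scaleC :: "complex \<Rightarrow> 'a \<Rightarrow> 'a" (infixr "*\<^sub>C" 75)
    and cinner :: "'a \<Rightarrow> 'a \<Rightarrow> complex"
  assumes scaleC_add_right: "c *\<^sub>C (x + y) = c *\<^sub>C x + c *\<^sub>C y"
    and scaleC_add_left: "(c + d) *\<^sub>C x = c *\<^sub>C x + d *\<^sub>C x"
    and scaleC_scaleC: "c *\<^sub>C (d *\<^sub>C x) = (c * d) *\<^sub>C x"
    and scaleC_one: "1 *\<^sub>C x = x"
    and scaleR_scaleC: "r *\<^sub>R x = complex_of_real r *\<^sub>C x"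
    and cinner_commute: "cinner x y = cnj (cinner y x)"
    and cinner_add_left: "cinner (x + y) z = cinner x z + cinner y z"
    and cinner_scaleC_left: "cinner (c *\<^sub>C x) y = c * cinner x y"
    and cinner_self: "cinner x x = complex_of_real ((norm x)\<^sup>2)"

class chilbert_space = complex_inner + complete_space

global_interpretation complex_vector:
  vector_space "scaleC :: complex \<Rightarrow> 'a \<Rightarrow> 'a::complex_inner"
  by unfold_locales (simp_all add: scaleC_add_right scaleC_add_left scaleC_scaleC scaleC_one)

definition infinite_dimensional :: "'a::complex_inner itself \<Rightarrow> bool" where
  "infinite_dimensional _ \<longleftrightarrow> \<not> (\<exists>B :: 'a set. finite B \<and> complex_vector.span B = UNIV)"

definition separable :: "'a::topological_space itself \<Rightarrow> bool" where
  "separable _ \<longleftrightarrow> (\<exists>D :: 'a set. countable D \<and> closure D = UNIV)"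

definition closed_csubspace :: "'a::complex_inner set \<Rightarrow> bool" where
  "closed_csubspace M \<longleftrightarrow> complex_vector.subspace M \<and> closed M"

definition bounded_clinear :: "('a::complex_inner \<Rightarrow> 'a) \<Rightarrow> bool" where
  "bounded_clinear T \<longleftrightarrow> bounded_linear T \<and> (\<forall>c x. T (c *\<^sub>C x) = c *\<^sub>C T x)"

(* The descriptions in cadjoint and abs_op denote the intended operators whenever T is bounded and
   the space is complete (Riesz representation, uniqueness of positive square roots). *)
definition cadjoint :: "('a::complex_inner \<Rightarrow> 'a) \<Rightarrow> 'a \<Rightarrow> 'a" where
  "cadjoint T = (THE S. \<forall>x y. cinner (T x) y = cinner x (S y))"

definition normal_op :: "('a::complex_inner \<Rightarrow> 'a) \<Rightarrow> bool" where
  "normal_op T \<longleftrightarrow> bounded_clinear T \<and> T \<circ> cadjoint T = cadjoint T \<circ> T"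

definition positive_op :: "('a::complex_inner \<Rightarrow> 'a) \<Rightarrow> bool" where
  "positive_op P \<longleftrightarrow> bounded_clinear P \<and> (\<forall>x. cinner (P x) x \<in> \<real>\<^sub>\<ge>\<^sub>0)"

definition abs_op :: "('a::complex_inner \<Rightarrow> 'a) \<Rightarrow> 'a \<Rightarrow> 'a" where
  "abs_op T = (THE P. positive_op P \<and> P \<circ> P = cadjoint T \<circ> T)"

definition point_spectrum :: "('a::complex_inner \<Rightarrow> 'a) \<Rightarrow> complex set" where
  "point_spectrum A = {c. \<exists>x. x \<noteq> 0 \<and> A x = c *\<^sub>C x}"

definition reduces :: "'a::complex_inner set \<Rightarrow> ('a \<Rightarrow> 'a) \<Rightarrow> bool" where
  "reduces M T \<longleftrightarrow> closed_csubspace M \<and> T ` M \<subseteq> M \<and> cadjoint T ` M \<subseteq> M"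

(* An operator on a closed subspace M is represented by a function on the whole space of which only
   the values on M matter; in particular the restriction of T to M is T itself, considered on M. *)
definition min_modulus_on :: "'a::complex_inner set \<Rightarrow> ('a \<Rightarrow> 'a) \<Rightarrow> real" where
  "min_modulus_on M A = Inf {norm (A x) | x. x \<in> M \<and> norm x = 1}"

definition min_attaining_on :: "'a::complex_inner set \<Rightarrow> ('a \<Rightarrow> 'a) \<Rightarrow> bool" where
  "min_attaining_on M A \<longleftrightarrow> (\<exists>x\<in>M. norm x = 1 \<and> norm (A x) = min_modulus_on M A)"

definition M_r :: "('a::complex_inner \<Rightarrow> 'a) set" where
  "M_r = {T. bounded_clinear T \<and>
             (\<forall>M. reduces M T \<and> M \<noteq> {0} \<longrightarrow> min_attaining_on M T)}"

definition bounded_clinear_on :: "'a::complex_inner set \<Rightarrow> ('a \<Rightarrow> 'a) \<Rightarrow> bool" where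
  "bounded_clinear_on M A \<longleftrightarrow>
     A ` M \<subseteq> M \<and>
     (\<forall>x\<in>M. \<forall>y\<in>M. A (x + y) = A x + A y) \<and>
     (\<forall>c. \<forall>x\<in>M. A (c *\<^sub>C x) = c *\<^sub>C A x) \<and>
     (\<exists>K. \<forall>x\<in>M. norm (A x) \<le> K * norm x)"

(* V is the adjoint of U on M. *)
definition unitary_on :: "'a::complex_inner set \<Rightarrow> ('a \<Rightarrow> 'a) \<Rightarrow> bool" where
  "unitary_on M U \<longleftrightarrow>
     bounded_clinear_on M U \<and>
     (\<exists>V. bounded_clinear_on M V \<and>
          (\<forall>x\<in>M. \<forall>y\<in>M. cinner (U x) y = cinner x (V y)) \<and>
          (\<forall>x\<in>M. V (U x) = x \<and> U (V x) = x))"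

(* Internal Hilbert space direct sum: pairwise orthogonal closed subspaces whose closed linear
   span is the whole space. *)
definition orthogonal_direct_sum :: "'i set \<Rightarrow> ('i \<Rightarrow> 'a::complex_inner set) \<Rightarrow> bool" where
  "orthogonal_direct_sum I H \<longleftrightarrow>
     (\<forall>i\<in>I. closed_csubspace (H i)) \<and>
     (\<forall>i\<in>I. \<forall>j\<in>I. i \<noteq> j \<longrightarrow> (\<forall>x\<in>H i. \<forall>y\<in>H j. cinner x y = 0)) \<and>
     closure (complex_vector.span (\<Union>i\<in>I. H i)) = UNIV"

end

theory Submission imports Defs begin

text \<open>
  The number \<open>a \<ge> 0\<close> is an eigenvalue of \<open>|T|\<close> iff \<open>a\<^sup>2\<close> is one of \<open>A = T\<^sup>* T\<close>, so everything can be read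
  off the eigenspaces \<open>E\<^sub>a = ker (A - a\<^sup>2)\<close>, which reduce \<open>T\<close> because \<open>T\<close> is normal. If \<open>M\<close> reduces \<open>T\<close>
  and the minimum modulus \<open>m\<close> of \<open>T\<close> on \<open>M\<close> is attained at \<open>x\<close>, then the form of \<open>A - m\<^sup>2\<close> is positive on
  \<open>M\<close> and vanishes at \<open>x\<close>, whence \<open>A x = m\<^sup>2 x\<close>. Applied to the orthogonal complement of all the
  \<open>E\<^sub>a\<close> this shows that they span a dense subspace; applied to the closed span of the \<open>E\<^sub>a\<close> with \<open>a\<close> in a
  given nonempty set of eigenvalues it yields a least element of that set. On \<open>E\<^sub>a\<close> the operator
  \<open>T / a\<close> is unitary. Conversely, a reducing subspace \<open>M\<close> is the closed span of the \<open>M \<inter> E\<^sub>a\<close>, so the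
  least \<open>a\<close> for which this intersection is nonzero is the minimum modulus on \<open>M\<close> and is attained.
\<close>

section \<open>Inner product calculus, Cauchy-Schwarz and closures of subspaces\<close>

lemma cinner_add_right: "cinner x (y + z) = cinner x y + cinner x (z::'a::complex_inner)"
  by (metis cinner_add_left cinner_commute complex_cnj_add)

lemma cinner_scaleC_right: "cinner x (c *\<^sub>C y) = cnj c * cinner x (y::'a::complex_inner)"
  by (metis cinner_commute cinner_scaleC_left complex_cnj_mult)

lemma cinner_zero_left [simp]: "cinner 0 (x::'a::complex_inner) = 0"
  using cinner_add_left[of 0 0 x] by simp

lemma cinner_zero_right [simp]: "cinner (x::'a::complex_inner) 0 = 0"
  using cinner_add_right[of x 0 0] by simp

lemma cinner_minus_left: "cinner (- x) y = - cinner x (y::'a::complex_inner)"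
  using cinner_add_left[of x "- x" y] by (simp add: add_eq_0_iff)

lemma cinner_minus_right: "cinner x (- y) = - cinner x (y::'a::complex_inner)"
  using cinner_add_right[of x y "- y"] by (simp add: add_eq_0_iff)

lemma cinner_diff_left: "cinner (x - y) z = cinner x z - cinner y (z::'a::complex_inner)"
  using cinner_add_left[of x "- y" z] by (simp add: cinner_minus_left)

lemma cinner_diff_right: "cinner x (y - z) = cinner x y - cinner x (z::'a::complex_inner)"
  using cinner_add_right[of x y "- z"] by (simp add: cinner_minus_right)

lemma cinner_scaleR_left: "cinner (r *\<^sub>R x) y = complex_of_real r * cinner x (y::'a::complex_inner)"
  by (simp add: scaleR_scaleC cinner_scaleC_left)

lemma cinner_scaleR_right: "cinner x (r *\<^sub>R y) = complex_of_real r * cinner x (y::'a::complex_inner)"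
  by (simp add: scaleR_scaleC cinner_scaleC_right)

lemma cinner_sum_left: "cinner (sum f A) y = (\<Sum>a\<in>A. cinner (f a) (y::'a::complex_inner))"
  by (induction A rule: infinite_finite_induct) (auto simp: cinner_add_left)

lemma cinner_sum_right: "cinner y (sum f A) = (\<Sum>a\<in>A. cinner (y::'a::complex_inner) (f a))"
  by (induction A rule: infinite_finite_induct) (auto simp: cinner_add_right)

lemmas cinner_simps = cinner_add_left cinner_add_right cinner_diff_left cinner_diff_right
  cinner_scaleC_left cinner_scaleC_right cinner_scaleR_left cinner_scaleR_right
  cinner_minus_left cinner_minus_right

lemma cinner_eq_0_commute: "cinner x y = 0 \<longleftrightarrow> cinner y (x::'a::complex_inner) = 0"
  by (metis cinner_commute complex_cnj_zero)

lemma Re_cinner_commute: "Re (cinner x y) = Re (cinner y (x::'a::complex_inner))"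
  by (subst cinner_commute) simp

lemma power2_norm_eq_Re_cinner: "(norm x)\<^sup>2 = Re (cinner x (x::'a::complex_inner))"
  by (simp add: cinner_self)

lemma cinner_self_eq_0 [simp]: "cinner x x = 0 \<longleftrightarrow> (x::'a::complex_inner) = 0"
  by (simp add: cinner_self)

lemma norm_scaleC: "norm (c *\<^sub>C x) = cmod c * norm (x::'a::complex_inner)"
proof -
  have "complex_of_real ((norm (c *\<^sub>C x))\<^sup>2) = (c * cnj c) * complex_of_real ((norm x)\<^sup>2)"
    by (simp only: cinner_simps mult.assoc mult.left_commute flip: cinner_self)
  also have "\<dots> = complex_of_real ((cmod c * norm x)\<^sup>2)"
    by (simp only: complex_norm_square[symmetric] power_mult_distrib of_real_mult of_real_power)
  finally have "(norm (c *\<^sub>C x))\<^sup>2 = (cmod c * norm x)\<^sup>2"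
    by (simp only: of_real_eq_iff)
  then show ?thesis by simp
qed

lemma norm_add_sq: "(norm (x + y))\<^sup>2 = (norm x)\<^sup>2 + 2 * Re (cinner x y) + (norm (y::'a::complex_inner))\<^sup>2"
  using Re_cinner_commute[of x y] by (simp add: power2_norm_eq_Re_cinner cinner_simps)

lemma norm_diff_sq: "(norm (x - y))\<^sup>2 = (norm x)\<^sup>2 - 2 * Re (cinner x y) + (norm (y::'a::complex_inner))\<^sup>2"
  using Re_cinner_commute[of x y] by (simp add: power2_norm_eq_Re_cinner cinner_simps)

text \<open>Pythagoras for \<open>x\<close> minus its orthogonal component along \<open>y\<close>.
  Both Cauchy-Schwarz and the orthogonality of the residual at a nearest point are read off from
  it.\<close>

lemma norm_sub_component_sq:
  fixes x y :: "'a::complex_inner"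
  assumes "y \<noteq> 0"
  shows "(norm (x - (cinner x y / complex_of_real ((norm y)\<^sup>2)) *\<^sub>C y))\<^sup>2 = (norm x)\<^sup>2 - (cmod (cinner x y) / norm y)\<^sup>2"
proof -
  define c where "c = cinner x y / complex_of_real ((norm y)\<^sup>2)"
  have "cnj c * cinner x y = complex_of_real ((cmod (cinner x y) / norm y)\<^sup>2)"
    using complex_norm_square[of "cinner x y"]
    by (simp add: c_def power_divide mult.commute)
  then have 1: "Re (cinner x (c *\<^sub>C y)) = (cmod (cinner x y) / norm y)\<^sup>2"
    by (simp only: cinner_simps Re_complex_of_real)
  have "norm (c *\<^sub>C y) = cmod (cinner x y) / norm y"
    using assms by (simp add: norm_scaleC c_def norm_divide norm_power power2_eq_square norm_mult)
  then show ?thesis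
    unfolding c_def[symmetric] norm_diff_sq 1 by simp
qed

lemma norm_cinner_le: "cmod (cinner x y) \<le> norm x * norm (y::'a::complex_inner)"
proof (cases "y = 0")
  case False
  then have "(cmod (cinner x y) / norm y)\<^sup>2 \<le> (norm x)\<^sup>2"
    using norm_sub_component_sq[OF False, of x] zero_le_power2 by (smt (verit))
  then have "cmod (cinner x y) / norm y \<le> norm x"
    by (simp add: power2_le_iff_abs_le)
  then show ?thesis using False by (simp add: field_simps)
qed simp

lemma bounded_bilinear_cinner: "bounded_bilinear (cinner :: 'a::complex_inner \<Rightarrow> 'a \<Rightarrow> complex)"
  by unfold_locales (auto simp: cinner_simps scaleR_conv_of_real intro!: exI[of _ 1] norm_cinner_le)

lemmas tendsto_cinner = bounded_bilinear.tendsto[OF bounded_bilinear_cinner]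
lemmas continuous_on_cinner = bounded_bilinear.continuous_on[OF bounded_bilinear_cinner]

lemma scaleR_scaleC_commute: "r *\<^sub>R c *\<^sub>C x = c *\<^sub>C r *\<^sub>R (x::'a::complex_inner)"
  by (simp add: scaleR_scaleC scaleC_scaleC mult.commute)

lemma bounded_linear_scaleC: "bounded_linear (\<lambda>x::'a::complex_inner. c *\<^sub>C x)"
  by unfold_locales
     (auto simp: scaleC_add_right scaleR_scaleC_commute norm_scaleC mult.commute intro!: exI[of _ "cmod c"])

lemma csubspace_scaleR: "complex_vector.subspace M \<Longrightarrow> x \<in> M \<Longrightarrow> r *\<^sub>R x \<in> (M::'a::complex_inner set)"
  by (simp add: scaleR_scaleC complex_vector.subspace_scale)

lemma closure_csubspace:
  assumes "complex_vector.subspace (M::'a::complex_inner set)"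
  shows "closed_csubspace (closure M)"
  unfolding closed_csubspace_def complex_vector.subspace_def
proof (intro conjI ballI allI)
  show "0 \<in> closure M"
    using assms closure_subset complex_vector.subspace_0 by blast
next
  fix x y assume "x \<in> closure M" "y \<in> closure M"
  then obtain f g where f: "\<And>n. f n \<in> M" "f \<longlonglongrightarrow> x" and g: "\<And>n. g n \<in> M" "g \<longlonglongrightarrow> y"
    unfolding closure_sequential by blast
  then show "x + y \<in> closure M"
    unfolding closure_sequential
    by (intro exI[of _ "\<lambda>n. f n + g n"]) (auto intro: tendsto_add complex_vector.subspace_add assms)
next
  fix c x assume "x \<in> closure M"
  then obtain f where f: "\<And>n. f n \<in> M" "f \<longlonglongrightarrow> x"
    unfolding closure_sequential by blast
  then show "c *\<^sub>C x \<in> closure M"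
    unfolding closure_sequential
    by (intro exI[of _ "\<lambda>n. c *\<^sub>C f n"])
       (auto intro: bounded_linear.tendsto[OF bounded_linear_scaleC] complex_vector.subspace_scale assms)
qed simp

section \<open>Orthogonal projections and adjoints\<close>

text \<open>A minimising sequence in \<open>M\<close> is Cauchy by the parallelogram law;
  completeness of the space and closedness of \<open>M\<close> provide its limit.\<close>

lemma nearest_point_exists:
  fixes M :: "'a::chilbert_space set"
  assumes M: "closed_csubspace M"
  shows "\<exists>u\<in>M. \<forall>y\<in>M. norm (x - u) \<le> norm (x - y)"
proof -
  have sub: "complex_vector.subspace M" and cl: "closed M" using M by (auto simp: closed_csubspace_def)
  have ne: "M \<noteq> {}" using complex_vector.subspace_0[OF sub] by auto
  define d where "d = infdist x M"
  have d0: "0 \<le> d" by (simp add: d_def infdist_nonneg)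
  have dle: "d \<le> norm (x - y)" if "y \<in> M" for y
    using infdist_le[OF that, of x] by (simp add: d_def dist_norm)
  have "\<exists>y\<in>M. norm (x - y) < d + e" if "e > 0" for e
    using ne that cInf_lessD[of "dist x ` M" "d + e"] by (auto simp: d_def infdist_def dist_norm)
  then have "\<forall>n. \<exists>y\<in>M. norm (x - y) < d + inverse (real (Suc n))"
    by simp
  then obtain f where f: "\<And>n. f n \<in> M" "\<And>n. norm (x - f n) < d + inverse (real (Suc n))"
    by metis
  have lim: "(\<lambda>n. norm (x - f n)) \<longlonglongrightarrow> d"
  proof (rule tendsto_sandwich[where f = "\<lambda>_. d"])
    show "(\<lambda>n. d + inverse (real (Suc n))) \<longlonglongrightarrow> d"
      using LIMSEQ_inverse_real_of_nat_add[of d] by simp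
    show "\<forall>\<^sub>F n in sequentially. norm (x - f n) \<le> d + inverse (real (Suc n))"
      using f(2) by (intro always_eventually allI less_imp_le)
    show "\<forall>\<^sub>F n in sequentially. d \<le> norm (x - f n)"
      using f(1) dle by simp
  qed simp
  \<comment> \<open>Parallelogram law for \<open>x - f m\<close> and \<open>x - f n\<close>: half
    their sum is \<open>x\<close> minus the midpoint of \<open>f m\<close> and \<open>f n\<close>,
    which lies in \<open>M\<close> and so has distance at least \<open>d\<close> from
    \<open>x\<close>.\<close>
  have mid: "(norm (f m - f n))\<^sup>2 \<le> 2 * (norm (x - f m))\<^sup>2 + 2 * (norm (x - f n))\<^sup>2 - 4 * d\<^sup>2" for m n
  proof -
    have "(1/2) *\<^sub>R (f m + f n) \<in> M"
      by (intro csubspace_scaleR sub complex_vector.subspace_add f)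
    then have "d\<^sup>2 \<le> (norm (x - (1/2) *\<^sub>R (f m + f n)))\<^sup>2"
      using dle d0 by (simp add: power_mono)
    moreover have "x - (1/2) *\<^sub>R (f m + f n) = (1/2) *\<^sub>R ((x - f m) + (x - f n))"
      by (simp add: algebra_simps flip: scaleR_add_left)
    moreover have "f m - f n = (x - f n) - (x - f m)" by simp
    ultimately show ?thesis
      using norm_add_sq[of "x - f m" "x - f n"] norm_diff_sq[of "x - f n" "x - f m"]
        Re_cinner_commute[of "x - f n" "x - f m"]
      by (simp add: power_divide)
  qed
  have "Cauchy f"
  proof (rule metric_CauchyI)
    fix e :: real assume e: "e > 0"
    have "(\<lambda>n. (norm (x - f n))\<^sup>2) \<longlonglongrightarrow> d\<^sup>2" by (intro tendsto_intros lim)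
    then have "\<forall>\<^sub>F n in sequentially. (norm (x - f n))\<^sup>2 < d\<^sup>2 + e\<^sup>2 / 4"
      using e by (intro order_tendstoD) auto
    then obtain N where N: "\<And>n. n \<ge> N \<Longrightarrow> (norm (x - f n))\<^sup>2 < d\<^sup>2 + e\<^sup>2 / 4"
      by (auto simp: eventually_sequentially)
    have "dist (f m) (f n) < e" if "m \<ge> N" "n \<ge> N" for m n
    proof -
      have "(norm (f m - f n))\<^sup>2 < e\<^sup>2"
        using mid[of m n] N[OF that(1)] N[OF that(2)] by linarith
      then show ?thesis using e by (simp add: dist_norm power2_less_imp_less)
    qed
    then show "\<exists>N. \<forall>m\<ge>N. \<forall>n\<ge>N. dist (f m) (f n) < e" by blast
  qed
  then obtain u where u: "f \<longlonglongrightarrow> u"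
    using Cauchy_convergent convergent_def by blast
  have "u \<in> M" using cl f u by (auto simp: closed_sequential_limits)
  moreover have "(\<lambda>n. norm (x - f n)) \<longlonglongrightarrow> norm (x - u)" by (intro tendsto_intros u)
  then have "norm (x - u) = d" using lim LIMSEQ_unique by blast
  ultimately show ?thesis using dle by auto
qed

text \<open>If the residual \<open>x - u\<close> at the nearest point had a nonzero component along
  some \<open>y\<close> in \<open>M\<close>, adding that component to \<open>u\<close> would come
  strictly closer to \<open>x\<close>.\<close>

lemma orthogonal_decomposition:
  fixes M :: "'a::chilbert_space set"
  assumes "closed_csubspace M"
  shows "\<exists>u\<in>M. \<forall>y\<in>M. cinner (x - u) y = 0"
proof -
  obtain u where u: "u \<in> M" "\<And>y. y \<in> M \<Longrightarrow> norm (x - u) \<le> norm (x - y)"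
    using nearest_point_exists[OF assms] by blast
  have sub: "complex_vector.subspace M" using assms by (simp add: closed_csubspace_def)
  have "cinner (x - u) y = 0" if "y \<in> M" for y
  proof (cases "y = 0")
    case False
    define c where "c = cinner (x - u) y / complex_of_real ((norm y)\<^sup>2)"
    have "u + c *\<^sub>C y \<in> M"
      by (intro complex_vector.subspace_add complex_vector.subspace_scale sub u that)
    then have "(norm (x - u))\<^sup>2 \<le> (norm (x - u - c *\<^sub>C y))\<^sup>2"
      using u by (auto simp: diff_diff_eq intro!: power_mono)
    also have "\<dots> = (norm (x - u))\<^sup>2 - (cmod (cinner (x - u) y) / norm y)\<^sup>2"
      unfolding c_def by (rule norm_sub_component_sq[OF False])
    finally show ?thesis using False by (simp add: power2_le_iff_abs_le)
  qed simp
  then show ?thesis using u by blast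
qed

text \<open>The residual \<open>w\<close> of a vector outside the kernel is orthogonal to the
  kernel, and a suitable multiple of it represents \<open>f\<close>.\<close>

lemma riesz_representation:
  fixes f :: "'a::chilbert_space \<Rightarrow> complex"
  assumes f: "bounded_linear f" and fC: "\<And>c x. f (c *\<^sub>C x) = c * f x"
  shows "\<exists>y. \<forall>x. f x = cinner x y"
proof (cases "\<forall>x. f x = 0")
  case True
  then show ?thesis by (intro exI[of _ 0]) simp
next
  case False
  then obtain z where z: "f z \<noteq> 0" by blast
  interpret f: bounded_linear f by (rule f)
  have "closed_csubspace {x. f x = 0}"
    unfolding closed_csubspace_def complex_vector.subspace_def
  proof
    show "closed {x. f x = 0}"
      by (rule closed_Collect_eq[OF f.continuous_on[OF continuous_on_id] continuous_on_const])
  qed (simp add: f.zero f.add fC)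
  from orthogonal_decomposition[OF this, of z]
  obtain u where u: "f u = 0" "\<And>y. f y = 0 \<Longrightarrow> cinner (z - u) y = 0"
    by auto
  define w where "w = z - u"
  have w0: "w \<noteq> 0" using z u by (auto simp: w_def)
  have "f x = cinner x ((cnj (f w) / complex_of_real ((norm w)\<^sup>2)) *\<^sub>C w)" for x
  proof -
    \<comment> \<open>This combination lies in the kernel of \<open>f\<close>, hence is orthogonal
      to \<open>w\<close>; the resulting equation is solved for \<open>f x\<close>.\<close>
    have "f (f w *\<^sub>C x - f x *\<^sub>C w) = 0" by (simp add: f.diff fC)
    then have "cinner (f w *\<^sub>C x - f x *\<^sub>C w) w = 0"
      using u(2) by (simp add: w_def cinner_eq_0_commute)
    then have "f w * cinner x w = f x * complex_of_real ((norm w)\<^sup>2)"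
      by (simp add: cinner_simps cinner_self)
    then show ?thesis using w0 by (simp add: cinner_simps field_simps)
  qed
  then show ?thesis by blast
qed

lemma bounded_clinear_bounded_linear: "bounded_clinear T \<Longrightarrow> bounded_linear T"
  by (simp add: bounded_clinear_def)

lemma bounded_clinear_scaleC: "bounded_clinear T \<Longrightarrow> T (c *\<^sub>C x) = c *\<^sub>C T x"
  by (simp add: bounded_clinear_def)

lemma cinner_ext: 
  fixes a b :: "'a::complex_inner"
  assumes "\<And>x. cinner x a = cinner x b"
  shows "a = b"
proof -
  have "cinner (a - b) (a - b) = 0"
    using assms[of "a - b"] by (simp add: cinner_diff_right)
  then show ?thesis by simp
qed

text \<open>Riesz representation yields a function with the defining property of the adjoint and
  \<open>cinner_ext\<close> its uniqueness, so the description in \<open>cadjoint\<close>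
  denotes.\<close>

lemma cinner_cadjoint:
  fixes T :: "'a::chilbert_space \<Rightarrow> 'a"
  assumes "bounded_clinear T"
  shows "cinner (T x) y = cinner x (cadjoint T y)"
proof -
  have "\<exists>z. \<forall>x. cinner (T x) y = cinner x z" for y
  proof (rule riesz_representation)
    show "bounded_linear (\<lambda>x. cinner (T x) y)"
      by (rule bounded_linear_compose[OF
            bounded_bilinear.bounded_linear_left[OF bounded_bilinear_cinner]
            bounded_clinear_bounded_linear[OF assms]])
  qed (simp add: bounded_clinear_scaleC[OF assms] cinner_simps)
  then obtain S where S: "\<And>x y. cinner (T x) y = cinner x (S y)" by metis
  have "cadjoint T = S"
    unfolding cadjoint_def
  proof (rule the_equality)
    fix S' assume S': "\<forall>x y. cinner (T x) y = cinner x (S' y)"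
    show "S' = S"
    proof
      fix y show "S' y = S y" by (rule cinner_ext) (metis S S')
    qed
  qed (use S in blast)
  then show ?thesis using S by simp
qed

lemma cinner_cadjoint':
  fixes T :: "'a::chilbert_space \<Rightarrow> 'a"
  assumes "bounded_clinear T"
  shows "cinner (cadjoint T x) y = cinner x (T y)"
  by (metis assms cinner_cadjoint cinner_commute)

lemma norm_cadjoint_le:
  fixes T :: "'a::chilbert_space \<Rightarrow> 'a"
  assumes T: "bounded_clinear T" and K: "\<And>x. norm (T x) \<le> K * norm x"
  shows "norm (cadjoint T x) \<le> K * norm x"
proof (cases "cadjoint T x = 0")
  case True
  then show ?thesis using K[of x] order_trans[OF norm_ge_zero K] by simp
next
  case False
  have "(norm (cadjoint T x))\<^sup>2 = Re (cinner (T (cadjoint T x)) x)"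
    by (simp add: power2_norm_eq_Re_cinner cinner_cadjoint[OF T])
  also have "\<dots> \<le> cmod (cinner (T (cadjoint T x)) x)" by (rule complex_Re_le_cmod)
  also have "\<dots> \<le> norm (T (cadjoint T x)) * norm x" by (rule norm_cinner_le)
  also have "\<dots> \<le> K * norm (cadjoint T x) * norm x" by (intro mult_right_mono K) auto
  finally show ?thesis using False by (simp add: power2_eq_square mult.assoc mult.left_commute)
qed

lemma bounded_clinear_cadjoint:
  fixes T :: "'a::chilbert_space \<Rightarrow> 'a"
  assumes "bounded_clinear T"
  shows "bounded_clinear (cadjoint T)"
proof -
  obtain K where K: "\<And>x. norm (T x) \<le> norm x * K"
    using bounded_linear.bounded[OF bounded_clinear_bounded_linear[OF assms]] by blast
  have C: "cadjoint T (c *\<^sub>C x) = c *\<^sub>C cadjoint T x" for c x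
    by (rule cinner_ext) (simp add: cinner_simps flip: cinner_cadjoint[OF assms])
  have "bounded_linear (cadjoint T)"
  proof (rule bounded_linear_intro)
    show "cadjoint T (x + y) = cadjoint T x + cadjoint T y" for x y
      by (rule cinner_ext) (simp add: cinner_simps flip: cinner_cadjoint[OF assms])
    show "cadjoint T (r *\<^sub>R x) = r *\<^sub>R cadjoint T x" for r x
      by (simp add: scaleR_scaleC C)
    show "norm (cadjoint T x) \<le> norm x * K" for x
      using norm_cadjoint_le[OF assms, of K x] K by (simp add: mult.commute)
  qed
  then show ?thesis using C by (simp add: bounded_clinear_def)
qed

section \<open>Square roots of positive operators\<close>

instance chilbert_space \<subseteq> banach ..

text \<open>Iterates the map sending Y to half of B + Y^2. A fixed point satisfies (1 - Y)^2 = 1 -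
  B, so 1 - Y is a square root of 1 - B.\<close>

primrec sqrt_iter :: "('a::real_normed_vector \<Rightarrow>\<^sub>L 'a) \<Rightarrow> nat \<Rightarrow> ('a \<Rightarrow>\<^sub>L 'a)" where
  "sqrt_iter B 0 = 0"
| "sqrt_iter B (Suc n) = (1/2) *\<^sub>R (B + (sqrt_iter B n o\<^sub>L sqrt_iter B n))"

text \<open>The same iteration with the number 1 in place of \<open>B\<close>; it majorises the
  norms and the increments of \<open>sqrt_iter B\<close> whenever
  \<open>norm B \<le> 1\<close>.\<close>

primrec scalar_sqrt_iter :: "nat \<Rightarrow> real" where
  "scalar_sqrt_iter 0 = 0"
| "scalar_sqrt_iter (Suc n) = (1 + (scalar_sqrt_iter n)\<^sup>2) / 2"

lemma scalar_sqrt_iter_bounds: "0 \<le> scalar_sqrt_iter n \<and> scalar_sqrt_iter n \<le> 1"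
  by (induction n) (auto simp: power_le_one)

lemma scalar_sqrt_iter_mono: "scalar_sqrt_iter n \<le> scalar_sqrt_iter (Suc n)"
  using zero_le_power2[of "scalar_sqrt_iter n - 1"] by (simp add: power2_diff)

lemma convergent_scalar_sqrt_iter: "convergent scalar_sqrt_iter"
  using scalar_sqrt_iter_bounds scalar_sqrt_iter_mono
  by (intro Bseq_mono_convergent BseqI'[where K = 1]) (auto intro: lift_Suc_mono_le)

lemma norm_sqrt_iter_le:
  assumes "norm B \<le> 1"
  shows "norm (sqrt_iter B n) \<le> scalar_sqrt_iter n"
proof (induction n)
  case (Suc n)
  have "norm (sqrt_iter B (Suc n)) \<le> (norm B + norm (sqrt_iter B n o\<^sub>L sqrt_iter B n)) / 2"
    by (simp add: norm_triangle_ineq)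
  moreover have "norm (sqrt_iter B n o\<^sub>L sqrt_iter B n) \<le> norm (sqrt_iter B n) * norm (sqrt_iter B n)"
    by (rule norm_blinfun_compose)
  moreover have "norm (sqrt_iter B n) * norm (sqrt_iter B n) \<le> scalar_sqrt_iter n * scalar_sqrt_iter n"
    by (intro mult_mono Suc) (auto simp: scalar_sqrt_iter_bounds)
  ultimately show ?case using assms by (simp add: power2_eq_square)
qed simp

text \<open>Comparing with the scalar iteration gives norm convergence even when \<open>norm B = 1\<close>, where
  the iterated map is not a contraction.\<close>

lemma norm_sqrt_iter_Suc_diff_le:
  assumes "norm B \<le> 1"
  shows "norm (sqrt_iter B (Suc n) - sqrt_iter B n) \<le> scalar_sqrt_iter (Suc n) - scalar_sqrt_iter n"
proof (induction n)
  case 0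
  then show ?case using assms by simp
next
  case (Suc n)
  let ?Y = "sqrt_iter B" and ?q = "scalar_sqrt_iter"
  let ?D = "?Y (Suc n) - ?Y n" and ?d = "?q (Suc n) - ?q n"
  \<comment> \<open>Noncommutative difference of squares: SS - RR = S(S - R) + (S - R)R. The scalar
    iterates obey the same identity, so the norm estimates match term by term.\<close>
  have eq: "?Y (Suc (Suc n)) - ?Y (Suc n) = (1/2) *\<^sub>R ((?Y (Suc n) o\<^sub>L ?D) + (?D o\<^sub>L ?Y n))"
    unfolding sqrt_iter.simps(2)[of B "Suc n"] sqrt_iter.simps(2)[of B n, folded scaleR_right_diff_distrib]
    by (simp del: sqrt_iter.simps(2)
          add: blinfun.bilinear_simps bounded_bilinear.diff_left[OF bounded_bilinear_blinfun_compose]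
               bounded_bilinear.diff_right[OF bounded_bilinear_blinfun_compose]
               flip: scaleR_right_diff_distrib)
  have "norm (?Y (Suc (Suc n)) - ?Y (Suc n)) \<le> (norm (?Y (Suc n) o\<^sub>L ?D) + norm (?D o\<^sub>L ?Y n)) / 2"
    unfolding eq by (simp add: norm_triangle_ineq del: sqrt_iter.simps)
  also have "\<dots> \<le> (norm (?Y (Suc n)) * norm ?D + norm ?D * norm (?Y n)) / 2"
    by (intro divide_right_mono add_mono norm_blinfun_compose) auto
  also have "\<dots> \<le> (?q (Suc n) * ?d + ?d * ?q n) / 2"
    using norm_sqrt_iter_le[OF assms] scalar_sqrt_iter_bounds scalar_sqrt_iter_mono Suc
    by (intro divide_right_mono add_mono mult_mono) (auto simp del: sqrt_iter.simps scalar_sqrt_iter.simps)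
  also have "\<dots> = ?q (Suc (Suc n)) - ?q (Suc n)"
    by (simp only: scalar_sqrt_iter.simps(2)[of "Suc n"])
       (subst (5) scalar_sqrt_iter.simps(2), simp add: field_simps power2_eq_square del: scalar_sqrt_iter.simps)
  finally show ?case .
qed

text \<open>The increments telescope against those of a convergent scalar sequence, so the iterates
  are Cauchy in operator norm; the equation for \<open>Y\<close> is the limit of the
  recursion.\<close>

lemma sqrt_iter_converges:
  fixes B :: "'a::banach \<Rightarrow>\<^sub>L 'a"
  assumes "norm B \<le> 1"
  obtains Y where "sqrt_iter B \<longlonglongrightarrow> Y" "norm Y \<le> 1" "Y o\<^sub>L Y = 2 *\<^sub>R Y - B"
proof -
  have diff: "norm (sqrt_iter B (n + k) - sqrt_iter B n) \<le> scalar_sqrt_iter (n + k) - scalar_sqrt_iter n" for n k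
  proof (induction k)
    case (Suc k)
    then show ?case
      using norm_sqrt_iter_Suc_diff_le[OF assms, of "n + k"]
        norm_triangle_ineq[of "sqrt_iter B (Suc (n + k)) - sqrt_iter B (n + k)" "sqrt_iter B (n + k) - sqrt_iter B n"]
      by (simp del: sqrt_iter.simps scalar_sqrt_iter.simps)
  qed simp
  have "Cauchy (sqrt_iter B)"
  proof (rule CauchyI')
    fix e :: real assume "e > 0"
    moreover have "Cauchy scalar_sqrt_iter"
      using convergent_scalar_sqrt_iter convergent_Cauchy by blast
    ultimately obtain N where N: "\<And>m n. m \<ge> N \<Longrightarrow> n \<ge> N \<Longrightarrow> norm (scalar_sqrt_iter m - scalar_sqrt_iter n) < e"
      using CauchyD by blast
    have "dist (sqrt_iter B m) (sqrt_iter B n) < e" if "m \<ge> N" "n > m" for m n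
      using diff[of m "n - m"] N[of n m] that by (simp add: dist_norm norm_minus_commute)
    then show "\<exists>N. \<forall>m\<ge>N. \<forall>n>m. dist (sqrt_iter B m) (sqrt_iter B n) < e" by blast
  qed
  then obtain Y where Y: "sqrt_iter B \<longlonglongrightarrow> Y"
    using Cauchy_convergent convergent_def by blast
  have "norm (sqrt_iter B n) \<le> 1" for n
    using norm_sqrt_iter_le[OF assms] scalar_sqrt_iter_bounds order_trans by blast
  then have "norm Y \<le> 1"
    using LIMSEQ_le_const2[OF tendsto_norm[OF Y]] by blast
  moreover have "(\<lambda>n. sqrt_iter B (Suc n)) \<longlonglongrightarrow> (1/2) *\<^sub>R (B + (Y o\<^sub>L Y))"
    unfolding sqrt_iter.simps
    by (intro tendsto_intros bounded_bilinear.tendsto[OF bounded_bilinear_blinfun_compose] Y)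
  then have "Y = (1/2) *\<^sub>R (B + (Y o\<^sub>L Y))"
    using Y LIMSEQ_unique LIMSEQ_Suc by blast
  from arg_cong[OF this, of "\<lambda>Z. 2 *\<^sub>R Z"]
  have "2 *\<^sub>R Y = B + (Y o\<^sub>L Y)" by (simp only: scaleR_scaleR) simp
  then have "Y o\<^sub>L Y = 2 *\<^sub>R Y - B" by simp
  ultimately show thesis using that Y by blast
qed

text \<open>Every iterate is a polynomial in \<open>B\<close>. In the limit this makes the square
  root commute with whatever commutes with the operator under the root.\<close>

lemma sqrt_iter_commute:
  assumes "C o\<^sub>L B = B o\<^sub>L C"
  shows "C o\<^sub>L sqrt_iter B n = sqrt_iter B n o\<^sub>L C"
proof (induction n)
  case (Suc n)
  have "C o\<^sub>L (sqrt_iter B n o\<^sub>L sqrt_iter B n) = (sqrt_iter B n o\<^sub>L sqrt_iter B n) o\<^sub>L C"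
    by (metis (no_types) Suc blinfun_eqI blinfun_apply_blinfun_compose)
  then show ?case
    by (simp add: assms bounded_bilinear.add_left[OF bounded_bilinear_blinfun_compose]
         bounded_bilinear.add_right[OF bounded_bilinear_blinfun_compose]
         bounded_bilinear.scaleR_left[OF bounded_bilinear_blinfun_compose]
         bounded_bilinear.scaleR_right[OF bounded_bilinear_blinfun_compose])
qed simp

text \<open>Since the quadratic form is real, the symmetry defect \<open>s\<close> vanishes on the
  diagonal. Polarising at \<open>x + y\<close> makes \<open>s\<close> antisymmetric, polarising at
  \<open>x + \<i> *\<^sub>C y\<close> makes it symmetric.\<close>

lemma positive_op_symmetric:
  assumes "positive_op P"
  shows "cinner (P x) y = cinner x (P y)"
proof -
  have P: "bounded_clinear P" and nn: "\<And>x. cinner (P x) x \<in> \<real>\<^sub>\<ge>\<^sub>0"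
    using assms by (auto simp: positive_op_def)
  have PC: "P (c *\<^sub>C x) = c *\<^sub>C P x" for c x by (rule bounded_clinear_scaleC[OF P])
  have PA: "P (x + y) = P x + P y" for x y
    by (rule linear_add[OF bounded_linear.linear[OF bounded_clinear_bounded_linear[OF P]]])
  define s where "s x y = cinner (P x) y - cinner x (P y)" for x y
  have s0: "s x x = 0" for x
  proof -
    have "cnj (cinner (P x) x) = cinner (P x) x"
      using nn[of x] by (simp add: complex_nonneg_Reals_iff complex_eq_iff)
    then show ?thesis using cinner_commute[of x "P x"] by (simp add: s_def)
  qed
  have 1: "s x y + s y x = 0"
    using s0[of "x + y"] s0[of x] s0[of y] by (simp add: s_def cinner_simps PA algebra_simps)
  have "\<i> * (s y x - s x y) = 0"
    using s0[of "x + \<i> *\<^sub>C y"] s0[of x] s0[of y] by (simp add: s_def cinner_simps PA PC algebra_simps)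
  then have "s y x = s x y" by simp
  then have "s x y = 0" using 1 by simp
  then show ?thesis by (simp add: s_def)
qed

text \<open>A zero of a nonnegative form is a minimum on \<open>M\<close>, so the gradient
  \<open>R y\<close> vanishes there: otherwise a small step from \<open>y\<close> against
  \<open>R y\<close>, which stays in \<open>M\<close>, would make the form negative.\<close>

lemma positive_form_null_vector:
  assumes M: "complex_vector.subspace M" and R: "bounded_clinear R" "\<And>x. x \<in> M \<Longrightarrow> R x \<in> M"
    and sym: "\<And>x y. cinner (R x) y = cinner x (R y)"
    and pos: "\<And>x. x \<in> M \<Longrightarrow> 0 \<le> Re (cinner (R x) x)"
    and y: "y \<in> M" "Re (cinner (R y) y) = 0"
  shows "R y = 0"
proof (rule ccontr)
  assume nz: "R y \<noteq> 0"
  interpret R: bounded_linear R by (rule bounded_clinear_bounded_linear[OF R(1)])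
  define z k where "z = R y" and "k = Re (cinner (R z) z)"
  have z: "z \<in> M" "z \<noteq> 0" using y R nz by (auto simp: z_def)
  have k: "0 \<le> k" using pos z by (simp add: k_def)
  \<comment> \<open>The form at \<open>y - t *\<^sub>R z\<close> is
    \<open>t * (t * k - 2 * (norm z)\<^sup>2)\<close>, and this \<open>t\<close> keeps
    \<open>t * k\<close> below \<open>(norm z)\<^sup>2\<close>. The summand 1 makes the denominator
    positive even for \<open>k = 0\<close>.\<close>
  define t where "t = (norm z)\<^sup>2 / (k + 1)"
  have t: "t > 0" "t * (k + 1) = (norm z)\<^sup>2" using k z by (auto simp: t_def)
  have "y - t *\<^sub>R z \<in> M"
    by (intro complex_vector.subspace_diff csubspace_scaleR M y z)
  then have "0 \<le> Re (cinner (R (y - t *\<^sub>R z)) (y - t *\<^sub>R z))" by (rule pos)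
  also have "\<dots> = t * (t * k - 2 * (norm z)\<^sup>2)"
    using y(2) sym[of z y]
    by (simp add: R.diff R.scaleR cinner_simps cinner_self k_def power2_eq_square algebra_simps flip: z_def)
  also have "\<dots> < 0"
  proof (rule mult_pos_neg)
    show "t * k - 2 * (norm z)\<^sup>2 < 0" using t zero_le_power2[of "norm z"] unfolding distrib_left mult_1_right by linarith
  qed (rule t(1))
  finally show False by simp
qed

lemma positive_op_null_vector:
  assumes "positive_op P" "cinner (P y) y = 0"
  shows "P y = 0"
proof (rule positive_form_null_vector[OF complex_vector.subspace_UNIV, where R = P])
  show "cinner (P x) y = cinner x (P y)" for x y by (rule positive_op_symmetric[OF assms(1)])
qed (use assms in \<open>auto simp: positive_op_def complex_nonneg_Reals_iff\<close>)

lemma nonneg_Reals_add_eq_0: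
  fixes p q :: complex
  assumes "p \<in> \<real>\<^sub>\<ge>\<^sub>0" "q \<in> \<real>\<^sub>\<ge>\<^sub>0" "p + q = 0"
  shows "p = 0" "q = 0"
  using assms by (auto simp: complex_nonneg_Reals_iff complex_eq_iff)

text \<open>By commutation, P + Q maps \<open>y = P x - Q x\<close> to (P^2 - Q^2) x = 0. The two
  nonnegative forms at \<open>y\<close> thus add up to 0, so both operators kill \<open>y\<close>,
  and symmetry makes \<open>y\<close> orthogonal to itself.\<close>

lemma commuting_positive_sqrt_unique:
  assumes P: "positive_op P" and Q: "positive_op Q"
    and sq: "\<And>x. P (P x) = Q (Q x)" and comm: "\<And>x. P (Q x) = Q (P x)"
  shows "P = Q"
proof
  fix x
  interpret P: bounded_linear P using P by (simp add: positive_op_def bounded_clinear_def)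
  interpret Q: bounded_linear Q using Q by (simp add: positive_op_def bounded_clinear_def)
  define y where "y = P x - Q x"
  have "P y + Q y = 0" by (simp add: y_def P.diff Q.diff sq comm)
  then have sum0: "cinner (P y) y + cinner (Q y) y = 0" by (simp flip: cinner_add_left)
  have nn: "cinner (P y) y \<in> \<real>\<^sub>\<ge>\<^sub>0" "cinner (Q y) y \<in> \<real>\<^sub>\<ge>\<^sub>0"
    using P Q by (auto simp: positive_op_def)
  have "cinner (P y) y = 0" "cinner (Q y) y = 0"
    using nonneg_Reals_add_eq_0[OF nn sum0] by auto
  then have y0: "P y = 0" "Q y = 0" using positive_op_null_vector P Q by auto
  have "cinner y y = cinner (P x) y - cinner (Q x) y"
    by (subst (1) y_def) (rule cinner_diff_left)
  also have "\<dots> = 0" by (simp add: positive_op_symmetric[OF P] positive_op_symmetric[OF Q] y0)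
  finally show "P x = Q x" by (simp add: y_def)
qed

text \<open>With \<open>k\<close> a bound for \<open>T\<close> and A = T^* T, the operator 1 - A/k^2
  has norm at most 1; if \<open>Y\<close> is the limit of its iteration, k(1 - Y) is the root. The
  last clause, commutation with whatever commutes with A, serves the uniqueness of the root.\<close>

lemma positive_sqrt_exists:
  fixes T :: "'a::chilbert_space \<Rightarrow> 'a"
  assumes T: "bounded_clinear T"
  obtains P where "positive_op P" "\<And>x. P (P x) = cadjoint T (T x)"
    "\<And>C x. bounded_linear C \<Longrightarrow> (\<And>x. C (cadjoint T (T x)) = cadjoint T (T (C x))) \<Longrightarrow> C (P x) = P (C x)"
proof -
  define A where "A x = cadjoint T (T x)" for x
  note T' = bounded_clinear_cadjoint[OF T]
  note bl = bounded_clinear_bounded_linear[OF T] bounded_clinear_bounded_linear[OF T']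
  obtain k where k: "k > 0" "\<And>x. norm (T x) \<le> k * norm x"
    using bounded_linear.pos_bounded[OF bl(1)] by (auto simp: mult.commute)
  note k' = norm_cadjoint_le[OF T k(2)]
  have blA: "bounded_linear A"
    unfolding A_def by (rule bounded_linear_compose[OF bl(2) bl(1)])
  interpret A: bounded_linear A by (rule blA)
  define b where "b x = x - (1 / k\<^sup>2) *\<^sub>R A x" for x
  have blb: "bounded_linear b"
    unfolding b_def by (intro bounded_linear_sub bounded_linear_ident bounded_linear_compose[OF bounded_linear_scaleR_right blA])
  have symA: "cinner (A x) y = cinner x (A y)" for x y
    by (simp add: A_def cinner_cadjoint[OF T] cinner_cadjoint'[OF T])
  \<comment> \<open>The squared norm of \<open>b x\<close> expands to |x|^2 - 2|Tx|^2/k^2 +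
    |Ax|^2/k^4, and \<open>norm (A x) \<le> k * norm (T x)\<close> bounds the last term by half of
    the middle one.\<close>
  have normb: "norm (b x) \<le> norm x" for x
  proof -
    have 1: "Re (cinner x (A x)) = (norm (T x))\<^sup>2"
      by (simp add: A_def cinner_self flip: cinner_cadjoint[OF T])
    have "norm (A x) \<le> k * norm (T x)" unfolding A_def by (rule k')
    then have "(norm (A x))\<^sup>2 \<le> k\<^sup>2 * (norm (T x))\<^sup>2"
      using power_mono[of "norm (A x)" "k * norm (T x)" 2] by (simp add: power_mult_distrib)
    then have "(norm ((1 / k\<^sup>2) *\<^sub>R A x))\<^sup>2 \<le> (1 / k\<^sup>2) * (norm (T x))\<^sup>2"
      using k by (simp add: field_simps power2_eq_square)
    moreover have "0 \<le> (1 / k\<^sup>2) * (norm (T x))\<^sup>2" by simp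
    moreover have "Re (cinner x ((1 / k\<^sup>2) *\<^sub>R A x)) = (1 / k\<^sup>2) * (norm (T x))\<^sup>2"
      by (simp only: cinner_simps Re_complex_of_real 1 times_complex.sel Im_complex_of_real mult_zero_left diff_zero)
    ultimately have "(norm (b x))\<^sup>2 \<le> (norm x)\<^sup>2"
      unfolding b_def norm_diff_sq by linarith
    then show ?thesis by simp
  qed
  have symb: "cinner (b x) y = cinner x (b y)" for x y
    by (simp add: b_def cinner_simps symA)
  define B where "B = Blinfun b"
  have B: "blinfun_apply B = b" unfolding B_def by (rule bounded_linear_Blinfun_apply[OF blb])
  have "norm B \<le> 1" using normb by (intro norm_blinfun_bound) (auto simp: B)
  then obtain Y where Y: "sqrt_iter B \<longlonglongrightarrow> Y" "norm Y \<le> 1" "Y o\<^sub>L Y = 2 *\<^sub>R Y - B"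
    by (rule sqrt_iter_converges)
  have Yx: "(\<lambda>n. sqrt_iter B n x) \<longlonglongrightarrow> Y x" for x
    by (intro tendsto_intros Y)
  have comm: "C (Y x) = Y (C x)" if C: "bounded_linear C" and CA: "\<And>x. C (A x) = A (C x)" for C x
  proof -
    interpret C: bounded_linear C by (rule C)
    have CB: "blinfun_apply (Blinfun C) = C" by (rule bounded_linear_Blinfun_apply[OF C])
    have "Blinfun C o\<^sub>L B = B o\<^sub>L Blinfun C"
      by (rule blinfun_eqI) (simp add: CB B b_def C.diff C.scaleR CA)
    then have "Blinfun C o\<^sub>L sqrt_iter B n = sqrt_iter B n o\<^sub>L Blinfun C" for n
      by (rule sqrt_iter_commute)
    then have "C (sqrt_iter B n x) = sqrt_iter B n (C x)" for n
      by (metis CB blinfun_apply_blinfun_compose)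
    moreover have "(\<lambda>n. C (sqrt_iter B n x)) \<longlonglongrightarrow> C (Y x)" by (rule C.tendsto[OF Yx])
    ultimately show ?thesis using LIMSEQ_unique[OF Yx[of "C x"]] by simp
  qed
  \<comment> \<open>\<open>Y\<close> arises as a real linear operator; its complex linearity is
    commutation with multiplication by \<open>c\<close>, which commutes with
    \<open>A\<close>.\<close>
  have YC: "Y (c *\<^sub>C x) = c *\<^sub>C Y x" for c x
    by (rule comm[symmetric, OF bounded_linear_scaleC])
       (simp add: A_def bounded_clinear_scaleC[OF T] bounded_clinear_scaleC[OF T'])
  have symYn: "cinner (sqrt_iter B n x) y = cinner x (sqrt_iter B n y)" for n x y
    by (induction n arbitrary: x y) (simp_all add: blinfun.bilinear_simps cinner_simps B symb)
  have symY: "cinner (Y x) y = cinner x (Y y)" for x y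
  proof (rule LIMSEQ_unique)
    show "(\<lambda>n. cinner (sqrt_iter B n x) y) \<longlonglongrightarrow> cinner (Y x) y"
      by (intro tendsto_cinner Yx tendsto_const)
    show "(\<lambda>n. cinner (sqrt_iter B n x) y) \<longlonglongrightarrow> cinner x (Y y)"
      unfolding symYn by (intro tendsto_cinner Yx tendsto_const)
  qed
  have normY: "norm (Y x) \<le> norm x" for x
    using norm_blinfun[of Y x] Y(2) mult_right_mono[OF Y(2), of "norm x"] by simp
  define P where "P x = k *\<^sub>R (x - Y x)" for x
  have YY: "Y (Y x) = 2 *\<^sub>R Y x - b x" for x
    using arg_cong[OF Y(3), of "\<lambda>Z. blinfun_apply Z x"] by (simp add: blinfun.bilinear_simps B)
  have blP: "bounded_linear P"
    unfolding P_def
    by (intro bounded_linear_compose[OF bounded_linear_scaleR_right] bounded_linear_sub bounded_linear_ident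
              blinfun.bounded_linear_right)
  have "cinner (P x) x \<in> \<real>\<^sub>\<ge>\<^sub>0" for x
  proof -
    have "Im (cinner (Y x) x) = 0"
      using symY[of x x] cinner_commute[of "Y x" x] by (metis Reals_cnj_iff complex_is_Real_iff)
    moreover have "Re (cinner (Y x) x) \<le> (norm x)\<^sup>2"
      using complex_Re_le_cmod[of "cinner (Y x) x"] norm_cinner_le[of "Y x" x]
        mult_right_mono[OF normY[of x], of "norm x"]
      by (simp add: power2_eq_square)
    ultimately show ?thesis
      using k by (simp add: P_def complex_nonneg_Reals_iff cinner_simps cinner_self)
  qed
  moreover have "P (c *\<^sub>C x) = c *\<^sub>C P x" for c x
    by (simp add: P_def YC complex_vector.scale_right_diff_distrib scaleR_scaleC_commute scaleR_right_diff_distrib)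
  ultimately have "positive_op P"
    using blP by (simp add: positive_op_def bounded_clinear_def)
  moreover have "P (P x) = A x" for x
  proof -
    have "P (P x) = (k * k) *\<^sub>R (x - 2 *\<^sub>R Y x + Y (Y x))"
      by (simp add: P_def blinfun.bilinear_simps scaleR_2 algebra_simps)
    also have "x - 2 *\<^sub>R Y x + Y (Y x) = (1 / k\<^sup>2) *\<^sub>R A x"
      by (simp add: YY b_def)
    finally show ?thesis using k by (simp add: power2_eq_square)
  qed
  moreover have "C (P x) = P (C x)" if C: "bounded_linear C" and CA: "\<And>x. C (A x) = A (C x)" for C x
    using comm[OF C CA] by (simp add: P_def linear_diff linear_scale bounded_linear.linear[OF C])
  ultimately show thesis using that unfolding A_def by blast
qed

text \<open>Makes the description in \<open>abs_op\<close> denote: any positive root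
  \<open>Q\<close> commutes with its own square T^* T, hence with the constructed \<open>P\<close>,
  and commuting positive roots coincide.\<close>

lemma abs_op_properties:
  fixes T :: "'a::chilbert_space \<Rightarrow> 'a"
  assumes T: "bounded_clinear T"
  shows "positive_op (abs_op T)" "abs_op T (abs_op T x) = cadjoint T (T x)"
proof -
  obtain P where P: "positive_op P" "\<And>x. P (P x) = cadjoint T (T x)"
    "\<And>C x. bounded_linear C \<Longrightarrow> (\<And>x. C (cadjoint T (T x)) = cadjoint T (T (C x))) \<Longrightarrow> C (P x) = P (C x)"
    using positive_sqrt_exists[OF T] by metis
  have "abs_op T = P"
    unfolding abs_op_def
  proof (rule the_equality)
    show "positive_op P \<and> P \<circ> P = cadjoint T \<circ> T" using P by (auto simp: fun_eq_iff)
  next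
    fix Q assume Q: "positive_op Q \<and> Q \<circ> Q = cadjoint T \<circ> T"
    then have Q2: "\<And>x. Q (Q x) = cadjoint T (T x)" by (auto simp: fun_eq_iff)
    have "Q (P x) = P (Q x)" for x
      using Q by (intro P(3)) (auto simp: positive_op_def bounded_clinear_def simp flip: Q2)
    then show "Q = P"
      using Q P Q2 by (intro commuting_positive_sqrt_unique) auto
  qed
  then show "positive_op (abs_op T)" "abs_op T (abs_op T x) = cadjoint T (T x)"
    using P by auto
qed

section \<open>Reducing subspaces\<close>

lemma closed_csubspaceD:
  assumes "closed_csubspace M"
  shows "complex_vector.subspace M" "closed M"
  using assms by (auto simp: closed_csubspace_def)

lemma closure_span_minimal:
  assumes "closed_csubspace M" "X \<subseteq> M"
  shows "closure (complex_vector.span X) \<subseteq> M"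
  by (intro closure_minimal complex_vector.span_minimal assms closed_csubspaceD)

lemma closed_csubspace_closure_span: "closed_csubspace (closure (complex_vector.span (X::'a::complex_inner set)))"
  by (intro closure_csubspace complex_vector.subspace_span)

lemma subset_closure_span: "X \<subseteq> closure (complex_vector.span (X::'a::complex_inner set))"
  using complex_vector.span_superset closure_subset by blast

lemma closed_csubspace_orthogonal: "closed_csubspace {x::'a::complex_inner. \<forall>y\<in>M. cinner x y = 0}"
proof -
  have "closed {x::'a. cinner x y = 0}" for y
    by (rule closed_Collect_eq) (auto intro!: continuous_on_cinner continuous_on_id continuous_on_const)
  then have "closed (\<Inter>y\<in>M. {x::'a. cinner x y = 0})" by (intro closed_INT ballI)
  moreover have "(\<Inter>y\<in>M. {x::'a. cinner x y = 0}) = {x. \<forall>y\<in>M. cinner x y = 0}" by blast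
  ultimately show ?thesis
    by (simp add: closed_csubspace_def complex_vector.subspace_def cinner_simps)
qed

lemma orthogonal_closure_span:
  fixes X :: "'a::complex_inner set"
  assumes "\<And>x. x \<in> X \<Longrightarrow> cinner z x = 0" "x \<in> closure (complex_vector.span X)"
  shows "cinner z x = 0"
proof -
  have "closure (complex_vector.span X) \<subseteq> {x. \<forall>y\<in>{z}. cinner x y = 0}"
    using assms(1) by (intro closure_span_minimal closed_csubspace_orthogonal) (auto simp: cinner_eq_0_commute)
  then show ?thesis using assms(2) by (auto simp: cinner_eq_0_commute)
qed

text \<open>The projection \<open>u\<close> of \<open>z\<close> on the closed span of
  \<open>X\<close> stays in \<open>M\<close>, so \<open>z - u\<close> is a vector of
  \<open>M\<close> orthogonal to \<open>X\<close>.\<close>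

lemma total_subset_closure_span:
  fixes M :: "'a::chilbert_space set"
  assumes M: "closed_csubspace M" and X: "X \<subseteq> M"
    and total: "\<And>z. z \<in> M \<Longrightarrow> (\<And>x. x \<in> X \<Longrightarrow> cinner z x = 0) \<Longrightarrow> z = 0"
  shows "M \<subseteq> closure (complex_vector.span X)"
proof
  fix z assume z: "z \<in> M"
  obtain u where u: "u \<in> closure (complex_vector.span X)"
      "\<forall>y\<in>closure (complex_vector.span X). cinner (z - u) y = 0"
    using orthogonal_decomposition[OF closed_csubspace_closure_span, of X z] by blast
  have "u \<in> M" using u(1) closure_span_minimal[OF M X] by blast
  then have "z - u \<in> M" by (intro complex_vector.subspace_diff closed_csubspaceD[OF M] z)
  then have "z - u = 0" using total u(2) subset_closure_span by blast
  then show "z \<in> closure (complex_vector.span X)" using u(1) by simp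
qed

lemma image_closure_span_subset:
  assumes T: "bounded_clinear T" and X: "T ` X \<subseteq> X"
  shows "T ` closure (complex_vector.span X) \<subseteq> closure (complex_vector.span X)"
proof (rule image_closure_subset)
  interpret T: bounded_linear T by (rule bounded_clinear_bounded_linear[OF T])
  show "continuous_on (closure (complex_vector.span X)) T"
    by (rule T.continuous_on[OF continuous_on_id])
  have "T x \<in> complex_vector.span X" if "x \<in> complex_vector.span X" for x
    using that
  proof (induction rule: complex_vector.span_induct_alt)
    case base
    then show ?case by (simp add: T.zero complex_vector.span_zero)
  next
    case (step c x y)
    then have "T x \<in> complex_vector.span X" using X by (auto intro: complex_vector.span_base)
    then show ?case
      using step by (simp add: T.add bounded_clinear_scaleC[OF T] complex_vector.span_add complex_vector.span_scale)
  qed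
  then show "T ` complex_vector.span X \<subseteq> closure (complex_vector.span X)"
    using closure_subset by blast
qed simp

lemma reduces_closure_span:
  fixes T :: "'a::chilbert_space \<Rightarrow> 'a"
  assumes "bounded_clinear T" "T ` X \<subseteq> X" "cadjoint T ` X \<subseteq> X"
  shows "reduces (closure (complex_vector.span X)) T"
  unfolding reduces_def
  by (intro conjI closed_csubspace_closure_span image_closure_span_subset bounded_clinear_cadjoint assms)

lemma reduces_orthogonal:
  fixes T :: "'a::chilbert_space \<Rightarrow> 'a"
  assumes T: "bounded_clinear T" and M: "reduces M T"
  shows "reduces {x. \<forall>y\<in>M. cinner x y = 0} T"
  unfolding reduces_def
  using M by (intro conjI closed_csubspace_orthogonal)
    (auto simp: reduces_def cinner_cadjoint[OF T] cinner_cadjoint'[OF T])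

lemma nonzero_csubspace_unit_vector:
  assumes M: "complex_vector.subspace M" "M \<noteq> {0}"
  shows "\<exists>u\<in>M. norm u = 1"
proof -
  obtain x where "x \<in> M" "x \<noteq> 0"
    using M complex_vector.subspace_0[OF M(1)] by blast
  then show ?thesis
    by (intro bexI[of _ "(1 / norm x) *\<^sub>R x"]) (auto intro: csubspace_scaleR M)
qed

text \<open>Unit vectors from different members are at distance sqrt 2, so points of
  \<open>D\<close> within 1/2 of them are distinct and the index set injects into
  \<open>D\<close>.\<close>

lemma countable_orthogonal_family:
  fixes E :: "'i \<Rightarrow> 'a::complex_inner set"
  assumes sep: "separable TYPE('a)"
    and E: "\<And>a. a \<in> I \<Longrightarrow> \<exists>x\<in>E a. norm x = 1"
    and orth: "\<And>a b x y. a \<in> I \<Longrightarrow> b \<in> I \<Longrightarrow> a \<noteq> b \<Longrightarrow> x \<in> E a \<Longrightarrow> y \<in> E b \<Longrightarrow> cinner x y = 0"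
  shows "countable I"
proof -
  obtain D :: "'a set" where D: "countable D" "closure D = UNIV"
    using sep by (auto simp: separable_def)
  obtain e where e: "\<And>a. a \<in> I \<Longrightarrow> e a \<in> E a" "\<And>a. a \<in> I \<Longrightarrow> norm (e a) = 1"
    using E by metis
  have "\<exists>d\<in>D. dist d (e a) < 1/2" for a
    using closure_approachable[of "e a" D] D(2) by (metis UNIV_I half_gt_zero zero_less_one)
  then obtain d where d: "\<And>a. d a \<in> D" "\<And>a. dist (d a) (e a) < 1/2" by metis
  have "inj_on d I"
  proof (rule inj_onI, rule ccontr)
    fix a b assume ab: "a \<in> I" "b \<in> I" "d a = d b" "a \<noteq> b"
    have "dist (e a) (e b) < 1"
      using d(2)[of a] d(2)[of b] dist_triangle3[of "e a" "e b" "d a"] unfolding ab(3) by linarith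
    then have "(norm (e a - e b))\<^sup>2 < 1"
      using power_strict_mono[of "norm (e a - e b)" 1 2] by (simp add: dist_norm)
    moreover have "(norm (e a - e b))\<^sup>2 = 2"
      using orth[OF ab(1,2,4)] e ab by (simp add: norm_diff_sq)
    ultimately show False by simp
  qed
  moreover have "countable (d ` I)"
    using D(1) d(1) by (auto intro: countable_subset)
  ultimately show ?thesis by (rule countable_image_inj_on[rotated])
qed

text \<open>The linear order axioms hold on every set of reals, so the content is that
  well-foundedness of the strict part means existence of least elements.\<close>

lemma well_order_on_real_iff:
  fixes A :: "real set"
  shows "well_order_on A {(x, y). x \<in> A \<and> y \<in> A \<and> x \<le> y} \<longleftrightarrow>
    (\<forall>S. S \<subseteq> A \<and> S \<noteq> {} \<longrightarrow> (\<exists>m\<in>S. \<forall>a\<in>S. m \<le> a))" (is "well_order_on A ?r \<longleftrightarrow> ?R")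
proof -
  have "linear_order_on A ?r"
    by (auto simp: linear_order_on_def partial_order_on_def preorder_on_def refl_on_def trans_def
        antisym_def total_on_def)
  moreover have "wf (?r - Id) \<longleftrightarrow> ?R"
  proof
    assume wf: "wf (?r - Id)"
    show ?R
    proof (intro allI impI)
      fix S assume S: "S \<subseteq> A \<and> S \<noteq> {}"
      then obtain x where "x \<in> S" by blast
      with wf[unfolded wf_eq_minimal, rule_format]
      have "\<exists>m\<in>S. \<forall>y. (y, m) \<in> ?r - Id \<longrightarrow> y \<notin> S" .
      then obtain m where m: "m \<in> S" "\<forall>y. (y, m) \<in> ?r - Id \<longrightarrow> y \<notin> S" ..
      have "m \<le> a" if "a \<in> S" for a
        using m(1) m(2)[rule_format, of a] S that by (cases "m \<le> a") auto
      then show "\<exists>m\<in>S. \<forall>a\<in>S. m \<le> a" using m(1) by blast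
    qed
  next
    assume R: ?R
    show "wf (?r - Id)"
    proof (rule wfI_min)
      fix x Q assume x: "x \<in> (Q :: real set)"
      show "\<exists>z\<in>Q. \<forall>y. (y, z) \<in> ?r - Id \<longrightarrow> y \<notin> Q"
      \<comment> \<open>The relation lives on \<open>A\<close>: if \<open>Q\<close> misses
        \<open>A\<close>, any element of \<open>Q\<close> is minimal; otherwise the least element of
        \<open>Q \<inter> A\<close> is.\<close>
      proof (cases "Q \<inter> A = {}")
        case True
        then show ?thesis using x by blast
      next
        case False
        then obtain m where m: "m \<in> Q \<inter> A" "\<And>a. a \<in> Q \<inter> A \<Longrightarrow> m \<le> a"
          using R[rule_format, of "Q \<inter> A"] by auto
        have "y \<notin> Q" if "(y, m) \<in> ?r - Id" for y
        proof
          assume "y \<in> Q"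
          then have "m \<le> y" using that m(2)[of y] by blast
          then show False using that by simp
        qed
        then show ?thesis using m(1) by blast
      qed
    qed
  qed
  ultimately show ?thesis by (simp add: well_order_on_def)
qed

section \<open>Eigenspaces of the modulus\<close>

text \<open>For \<open>a \<ge> 0\<close> this is the eigenspace of \<open>abs_op T\<close> at \<open>a\<close>.\<close>
definition singular_space :: "('a::complex_inner \<Rightarrow> 'a) \<Rightarrow> real \<Rightarrow> 'a set" where
  "singular_space T a = {x. cadjoint T (T x) = a\<^sup>2 *\<^sub>R x}"

locale bounded_operator =
  fixes T :: "'a::chilbert_space \<Rightarrow> 'a"
  assumes T: "bounded_clinear T"
begin

sublocale T: bounded_linear T
  by (rule bounded_clinear_bounded_linear[OF T])

sublocale T': bounded_linear "cadjoint T"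
  by (rule bounded_clinear_bounded_linear[OF bounded_clinear_cadjoint[OF T]])

lemmas T_scaleC = bounded_clinear_scaleC[OF T]
lemmas T'_scaleC = bounded_clinear_scaleC[OF bounded_clinear_cadjoint[OF T]]

lemma cinner_TT: "cinner (cadjoint T (T x)) y = cinner (T x) (T y)"
  by (simp add: cinner_cadjoint'[OF T])

lemma cinner_TT': "cinner y (cadjoint T (T x)) = cinner (T y) (T x)"
  by (simp add: cinner_cadjoint[OF T])

lemma closed_csubspace_singular_space: "closed_csubspace (singular_space T a)"
  unfolding closed_csubspace_def singular_space_def
proof
  show "closed {x. cadjoint T (T x) = a\<^sup>2 *\<^sub>R x}"
    by (intro closed_Collect_eq T.continuous_on T'.continuous_on continuous_on_id
          continuous_on_scaleR continuous_on_const)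
qed (simp add: complex_vector.subspace_def T.zero T'.zero T.add T'.add T_scaleC T'_scaleC
      scaleR_add_right scaleR_scaleC_commute)

lemmas subspace_singular_space = closed_csubspaceD(1)[OF closed_csubspace_singular_space]

lemma norm_T_singular_space:
  assumes "x \<in> singular_space T a" "0 \<le> a"
  shows "norm (T x) = a * norm x"
proof -
  have "complex_of_real ((norm (T x))\<^sup>2) = complex_of_real ((a * norm x)\<^sup>2)"
    using assms cinner_TT[of x x]
    by (simp add: singular_space_def cinner_scaleR_left cinner_self power_mult_distrib)
  then have "(norm (T x))\<^sup>2 = (a * norm x)\<^sup>2" by (simp only: of_real_eq_iff)
  then show ?thesis using assms by (simp add: power2_eq_iff_nonneg)
qed

lemma singular_space_orthogonal:
  assumes "x \<in> singular_space T a" "y \<in> singular_space T b" "0 \<le> a" "0 \<le> b" "a \<noteq> b"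
  shows "cinner x y = 0"
proof -
  have "complex_of_real (a\<^sup>2) * cinner x y = complex_of_real (b\<^sup>2) * cinner x y"
    using assms(1,2) cinner_TT[of x y] cinner_TT'[of x y]
    by (simp only: singular_space_def mem_Collect_eq cinner_scaleR_left cinner_scaleR_right)
  moreover have "a\<^sup>2 \<noteq> b\<^sup>2" using assms(3-5) by (simp add: power2_eq_iff_nonneg)
  ultimately show ?thesis by (simp only: mult_cancel_right of_real_eq_iff) simp
qed

text \<open>Positivity makes eigenvalues of the modulus real and nonnegative, and squaring leads to
  T^* T. Conversely, T^* T - a^2 factors into |T| + a and |T| - a, where the first factor is
  positive.\<close>

lemma point_spectrum_abs_op_iff:
  "c \<in> point_spectrum (abs_op T) \<longleftrightarrow> (\<exists>a\<ge>0. c = complex_of_real a \<and> singular_space T a \<noteq> {0})"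
proof
  note P = abs_op_properties[OF T]
  interpret P: bounded_linear "abs_op T" using P(1) by (simp add: positive_op_def bounded_clinear_def)
  have PC: "abs_op T (c *\<^sub>C x) = c *\<^sub>C abs_op T x" for c x
    using P(1) by (simp add: positive_op_def bounded_clinear_def)
  {
    assume "c \<in> point_spectrum (abs_op T)"
    then obtain x where x: "x \<noteq> 0" "abs_op T x = c *\<^sub>C x" by (auto simp: point_spectrum_def)
    have "cinner (abs_op T x) x \<in> \<real>\<^sub>\<ge>\<^sub>0" using P(1) by (simp add: positive_op_def)
    then have "Re c * (norm x)\<^sup>2 \<ge> 0" "Im c * (norm x)\<^sup>2 = 0"
      by (simp_all add: x(2) cinner_simps cinner_self complex_nonneg_Reals_iff flip: of_real_power)
    then have a: "Re c \<ge> 0" "c = complex_of_real (Re c)"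
      using x(1) by (auto simp: zero_le_mult_iff complex_eq_iff)
    have "cadjoint T (T x) = c *\<^sub>C c *\<^sub>C x" by (simp add: x(2) PC flip: P(2))
    also have "\<dots> = (Re c)\<^sup>2 *\<^sub>R x"
      by (subst (1 2) a(2)) (simp add: scaleR_scaleC scaleC_scaleC power2_eq_square)
    finally have "x \<in> singular_space T (Re c)" by (simp add: singular_space_def)
    then show "\<exists>a\<ge>0. c = complex_of_real a \<and> singular_space T a \<noteq> {0}"
      using a x(1) by blast
  }
  {
    assume "\<exists>a\<ge>0. c = complex_of_real a \<and> singular_space T a \<noteq> {0}"
    then obtain a where a: "a \<ge> 0" "c = complex_of_real a" and "singular_space T a \<noteq> {0}" by blast
    then obtain x where x: "x \<noteq> 0" "x \<in> singular_space T a"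
      using complex_vector.subspace_0[OF subspace_singular_space[of a]] by blast
    define y where "y = abs_op T x - a *\<^sub>R x"
    have "abs_op T y + a *\<^sub>R y = 0"
      using x(2) by (simp add: y_def P.diff P.scaleR P(2) singular_space_def scaleR_right_diff_distrib power2_eq_square)
    then have sum0: "cinner (abs_op T y) y + complex_of_real a * cinner y y = 0"
      by (simp flip: cinner_add_left cinner_scaleR_left)
    have "cinner (abs_op T y) y \<in> \<real>\<^sub>\<ge>\<^sub>0" using P(1) by (simp add: positive_op_def)
    moreover have "complex_of_real a * cinner y y \<in> \<real>\<^sub>\<ge>\<^sub>0"
      using a by (simp add: cinner_self complex_nonneg_Reals_iff flip: of_real_power)
    \<comment> \<open>For \<open>a = 0\<close> the second equation does not give
      \<open>y = 0\<close>. The first yields \<open>abs_op T y = 0\<close>, and together they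
      annihilate both parts of \<open>cinner y y\<close>, which covers every
      \<open>a \<ge> 0\<close>.\<close>
    ultimately have 0: "cinner (abs_op T y) y = 0" "complex_of_real a * cinner y y = 0"
      using nonneg_Reals_add_eq_0[OF _ _ sum0] by auto
    from 0(1) have "abs_op T y = 0" by (rule positive_op_null_vector[OF P(1)])
    then have "cinner (abs_op T x) y = 0" by (simp add: positive_op_symmetric[OF P(1)])
    moreover have "complex_of_real a * cinner x y = 0" using 0(2) by auto
    ultimately have "cinner y y = 0"
      by (subst (1) y_def) (simp add: cinner_simps)
    then have "abs_op T x = c *\<^sub>C x" by (simp add: y_def a scaleR_scaleC)
    then show "c \<in> point_spectrum (abs_op T)" using x(1) by (auto simp: point_spectrum_def)
  }
qed

lemma singular_value_le_onorm:
  assumes "0 \<le> a" "singular_space T a \<noteq> {0}"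
  shows "a \<le> onorm T"
proof -
  obtain x where "x \<in> singular_space T a" "norm x = 1"
    using assms(2) nonzero_csubspace_unit_vector[OF subspace_singular_space[of a]] by blast
  then show ?thesis
    using norm_T_singular_space[of x a] onorm[OF T.bounded_linear_axioms, of x] assms(1) by simp
qed

section \<open>Minimum modulus on reducing subspaces\<close>

lemma min_modulus_on_le:
  assumes "x \<in> M" "norm x = 1"
  shows "min_modulus_on M T \<le> norm (T x)"
  unfolding min_modulus_on_def
  using assms by (intro cInf_lower bdd_belowI[of _ 0]) auto

text \<open>The quadratic form of R = T^* T - m^2 is |Ty|^2 - m^2 |y|^2. Because \<open>M\<close>
  reduces \<open>T\<close>, \<open>R\<close> maps \<open>M\<close> into itself, as
  \<open>positive_form_null_vector\<close> requires.\<close>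

lemma min_modulus_attained_singular:
  assumes M: "reduces M T" and x: "x \<in> M" "norm x = 1" "norm (T x) = min_modulus_on M T"
  shows "x \<in> singular_space T (norm (T x))"
proof -
  define m where "m = norm (T x)"
  have sub: "complex_vector.subspace M"
    using M closed_csubspaceD by (auto simp: reduces_def)
  have le: "m * norm y \<le> norm (T y)" if "y \<in> M" for y
  proof (cases "y = 0")
    case False
    then have "m \<le> norm (T ((1 / norm y) *\<^sub>R y))"
      unfolding m_def x(3) by (intro min_modulus_on_le csubspace_scaleR sub that) auto
    then show ?thesis using False by (simp add: T.scaleR field_simps)
  qed (simp add: T.zero)
  define R where "R y = cadjoint T (T y) - m\<^sup>2 *\<^sub>R y" for y
  have form: "Re (cinner (R y) y) = (norm (T y))\<^sup>2 - (m * norm y)\<^sup>2" for y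
    by (simp add: R_def cinner_simps cinner_TT cinner_self power_mult_distrib flip: of_real_mult of_real_power of_real_diff)
  have "R x = 0"
  proof (rule positive_form_null_vector[OF sub, where R = R])
    show "bounded_clinear R"
      unfolding bounded_clinear_def R_def
      by (intro conjI allI bounded_linear_sub bounded_linear_compose[OF T'.bounded_linear_axioms T.bounded_linear_axioms]
            bounded_linear_scaleR_right)
         (simp add: T_scaleC T'_scaleC complex_vector.scale_right_diff_distrib scaleR_scaleC_commute)
    show "R y \<in> M" if "y \<in> M" for y
      unfolding R_def using M that
      by (intro complex_vector.subspace_diff csubspace_scaleR sub) (auto simp: reduces_def)
    show "cinner (R y) z = cinner y (R z)" for y z
      by (simp add: R_def cinner_simps cinner_TT cinner_TT')
    show "0 \<le> Re (cinner (R y) y)" if "y \<in> M" for y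
      using le[OF that] by (simp add: form power_mono m_def)
    show "Re (cinner (R x) x) = 0" by (simp add: form m_def x(2))
  qed (rule x(1))
  then show ?thesis by (simp add: R_def singular_space_def m_def)
qed

text \<open>For a finite sum of singular vectors \<open>f a\<close> with distinct indices,
  orthogonality turns |Tx|^2 into the sum of a^2 |f a|^2, which is at least m^2 |x|^2. The
  inequality is a closed condition.\<close>

lemma norm_T_ge_on_closure_span:
  assumes I: "\<And>a. a \<in> I \<Longrightarrow> m \<le> a" and m: "0 \<le> m"
    and x: "x \<in> closure (complex_vector.span (\<Union>a\<in>I. singular_space T a))"
  shows "m * norm x \<le> norm (T x)"
proof -
  have "closure (complex_vector.span (\<Union>a\<in>I. singular_space T a)) \<subseteq> {x. m * norm x \<le> norm (T x)}"
  proof (rule closure_minimal)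
    show "closed {x. m * norm x \<le> norm (T x)}"
      by (intro closed_Collect_le continuous_on_mult continuous_on_const continuous_on_norm
            T.continuous_on continuous_on_id)
    show "complex_vector.span (\<Union>a\<in>I. singular_space T a) \<subseteq> {x. m * norm x \<le> norm (T x)}"
    proof
      fix x assume "x \<in> complex_vector.span (\<Union>a\<in>I. singular_space T a)"
      \<comment> \<open>Terms of a linear combination are collected by index, so that different
        summands are orthogonal.\<close>
      then have "\<exists>F f. finite F \<and> F \<subseteq> I \<and> (\<forall>a. f a \<in> singular_space T a) \<and> x = sum f F"
      proof (induction rule: complex_vector.span_induct_alt)
        case base
        then show ?case
          using complex_vector.subspace_0[OF subspace_singular_space]
          by (intro exI[of _ "{}"] exI[of _ "\<lambda>_. 0"]) auto
      next
        case (step c s y)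
        then obtain F f b where f: "finite F" "F \<subseteq> I" "\<And>a. f a \<in> singular_space T a" "y = sum f F"
          and b: "b \<in> I" "s \<in> singular_space T b" by blast
        \<comment> \<open>\<open>f\<close> may be nonzero outside \<open>F\<close>, so it is cut off
          there before the new term is added at \<open>b\<close>, whether or not \<open>b\<close>
          already lies in \<open>F\<close>.\<close>
        define g where "g a = (if a \<in> F then f a else 0) + (if a = b then c *\<^sub>C s else 0)" for a
        have "g a \<in> singular_space T a" for a
          using f(3)[of a] b complex_vector.subspace_0[OF subspace_singular_space[of a]]
          by (auto simp: g_def intro!: complex_vector.subspace_add complex_vector.subspace_scale subspace_singular_space)
        moreover have "sum g (insert b F) = c *\<^sub>C s + y"
        proof -
          have "(\<Sum>a\<in>insert b F. if a \<in> F then f a else 0) = sum f F"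
            using f(1) by (intro sum.mono_neutral_cong_right) auto
          then show ?thesis using f(1,4) by (simp add: g_def sum.distrib sum.delta del: sum.insert)
        qed
        ultimately show ?case
          using f(1,2) b(1) by (intro exI[of _ "insert b F"] exI[of _ g]) auto
      qed
      then obtain F f where f: "finite F" "F \<subseteq> I" "\<And>a. f a \<in> singular_space T a" "x = sum f F"
        by blast
      have orth: "cinner (f a) x = complex_of_real ((norm (f a))\<^sup>2)" if "a \<in> F" for a
      proof -
        have "cinner (f a) x = (\<Sum>b\<in>F. if b = a then cinner (f a) (f a) else 0)"
          unfolding f(4) cinner_sum_right
        proof (rule sum.cong)
          fix b assume "b \<in> F"
          then have "0 \<le> a" "0 \<le> b" using that f(2) I m by force+
          then show "cinner (f a) (f b) = (if b = a then cinner (f a) (f a) else 0)"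
            using singular_space_orthogonal[OF f(3) f(3), of a b] by auto
        qed simp
        then show ?thesis using that f(1) by (simp add: cinner_self)
      qed
      have "cinner x x = (\<Sum>a\<in>F. cinner (f a) x)"
        by (subst (1) f(4)) (rule cinner_sum_left)
      then have nx: "(norm x)\<^sup>2 = (\<Sum>a\<in>F. (norm (f a))\<^sup>2)"
        by (simp add: power2_norm_eq_Re_cinner orth) 
      have "cadjoint T (T x) = (\<Sum>a\<in>F. a\<^sup>2 *\<^sub>R f a)"
        using f(3) by (simp add: f(4) T.sum T'.sum singular_space_def)
      then have "cinner (T x) (T x) = (\<Sum>a\<in>F. complex_of_real (a\<^sup>2) * cinner (f a) x)"
        by (simp add: cinner_sum_left cinner_scaleR_left flip: cinner_TT)
      then have nTx: "(norm (T x))\<^sup>2 = (\<Sum>a\<in>F. a\<^sup>2 * (norm (f a))\<^sup>2)"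
        by (simp add: power2_norm_eq_Re_cinner[of "T x"] orth flip: of_real_power of_real_mult)
      have "(m * norm x)\<^sup>2 = (\<Sum>a\<in>F. m\<^sup>2 * (norm (f a))\<^sup>2)"
        by (simp add: power_mult_distrib nx sum_distrib_left)
      also have "\<dots> \<le> (norm (T x))\<^sup>2"
        unfolding nTx
      proof (intro sum_mono mult_right_mono power_mono m zero_le_power2)
        show "m \<le> a" if "a \<in> F" for a using I f(2) that by blast
      qed
      finally have "m * norm x \<le> norm (T x)" by (rule power2_le_imp_le) simp
      then show "x \<in> {x. m * norm x \<le> norm (T x)}" ..
    qed
  qed
  then show ?thesis using x by blast
qed

text \<open>The components along \<open>M\<close> and its complement of a vector of a singular space lie in that
  singular space again.\<close>

lemma reduces_subset_closure_span:
  assumes M: "reduces M T"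
    and total: "closure (complex_vector.span (\<Union>a\<in>I. singular_space T a)) = UNIV"
  shows "M \<subseteq> closure (complex_vector.span (\<Union>a\<in>I. M \<inter> singular_space T a))"
proof (rule total_subset_closure_span)
  show clM: "closed_csubspace M" using M by (simp add: reduces_def)
  note sub = closed_csubspaceD(1)[OF clM]
  fix z assume z: "z \<in> M" and orth: "\<And>x. x \<in> (\<Union>a\<in>I. M \<inter> singular_space T a) \<Longrightarrow> cinner z x = 0"
  have "cinner z x = 0" if a: "a \<in> I" and x: "x \<in> singular_space T a" for a x
  proof -
    obtain u where u: "u \<in> M" "\<And>y. y \<in> M \<Longrightarrow> cinner (x - u) y = 0"
      using orthogonal_decomposition[OF clM, of x] by blast
    \<comment> \<open>\<open>w\<close> lies in \<open>M\<close>, which reduces \<open>T\<close>. As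
      \<open>x\<close> is singular, \<open>w\<close> is also a^2 - T^* T applied to
      \<open>x - u\<close>, hence orthogonal to \<open>M\<close>. So \<open>w\<close> is orthogonal
      to itself.\<close>
    define w where "w = cadjoint T (T u) - a\<^sup>2 *\<^sub>R u"
    have wM: "w \<in> M" if "u \<in> M"
      unfolding w_def using M that
      by (intro complex_vector.subspace_diff csubspace_scaleR sub) (auto simp: reduces_def)
    have w_eq: "w = a\<^sup>2 *\<^sub>R (x - u) - cadjoint T (T (x - u))"
      using x by (simp add: w_def singular_space_def T.diff T'.diff scaleR_right_diff_distrib)
    have "cinner (cadjoint T (T (x - u))) w = 0"
      using u(2)[of "cadjoint T (T w)"] M wM[OF u(1)]
      by (auto simp: cinner_TT cinner_TT' reduces_def)
    then have "cinner w w = 0"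
      using u(2)[OF wM[OF u(1)]] by (subst (1) w_eq) (simp add: cinner_diff_left cinner_scaleR_left)
    then have "u \<in> singular_space T a" by (simp add: w_def singular_space_def)
    then have "cinner z u = 0" using orth a u(1) by blast
    moreover have "cinner z (x - u) = 0" using u(2)[OF z] cinner_eq_0_commute by blast
    ultimately show ?thesis by (simp add: cinner_diff_right)
  qed
  then have "cinner z x = 0" if "x \<in> (\<Union>a\<in>I. singular_space T a)" for x
    using that by blast
  then have "cinner z z = 0"
    by (rule orthogonal_closure_span[where X = "\<Union>a\<in>I. singular_space T a"]) (simp_all only: total UNIV_I)
  then show "z = 0" by simp
qed blast

lemma M_r_if_singular_spaces_total:
  assumes I: "\<And>a. a \<in> I \<Longrightarrow> 0 \<le> a"
    and wo: "\<And>S. S \<subseteq> I \<Longrightarrow> S \<noteq> {} \<Longrightarrow> \<exists>m\<in>S. \<forall>a\<in>S. m \<le> a"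
    and total: "closure (complex_vector.span (\<Union>a\<in>I. singular_space T a)) = UNIV"
  shows "T \<in> M_r"
  unfolding M_r_def
proof (intro CollectI conjI allI impI T)
  fix M assume "reduces M T \<and> M \<noteq> {0}"
  then have M: "reduces M T" "M \<noteq> {0}" by auto
  have sub: "complex_vector.subspace M"
    using M(1) closed_csubspaceD by (auto simp: reduces_def)
  \<comment> \<open>Dropping the indices whose singular space meets \<open>M\<close> trivially loses
    only the zero vector, and it ensures that the least remaining index has a unit vector in
    \<open>M\<close>.\<close>
  define J where "J = {a \<in> I. M \<inter> singular_space T a \<noteq> {0}}"
  have "M \<subseteq> closure (complex_vector.span (\<Union>a\<in>I. M \<inter> singular_space T a))"
    by (rule reduces_subset_closure_span[OF M(1) total])
  also have "\<dots> \<subseteq> closure (complex_vector.span (\<Union>a\<in>J. singular_space T a))"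
  proof (rule closure_span_minimal[OF closed_csubspace_closure_span])
    show "(\<Union>a\<in>I. M \<inter> singular_space T a) \<subseteq> closure (complex_vector.span (\<Union>a\<in>J. singular_space T a))"
    proof
      fix x assume "x \<in> (\<Union>a\<in>I. M \<inter> singular_space T a)"
      then have "x = 0 \<or> x \<in> (\<Union>a\<in>J. singular_space T a)" unfolding J_def by blast
      then show "x \<in> closure (complex_vector.span (\<Union>a\<in>J. singular_space T a))"
        using subset_closure_span[of "\<Union>a\<in>J. singular_space T a"]
          complex_vector.subspace_0[OF closed_csubspaceD(1)[OF closed_csubspace_closure_span]]
        by blast
    qed
  qed
  finally have MJ: "M \<subseteq> closure (complex_vector.span (\<Union>a\<in>J. singular_space T a))" .
  have "J \<noteq> {}"
    using MJ M(2) complex_vector.subspace_0[OF sub] by auto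
  then obtain m where m: "m \<in> J" "\<And>a. a \<in> J \<Longrightarrow> m \<le> a"
    using wo[of J] by (auto simp: J_def)
  have m0: "0 \<le> m" using I m(1) by (auto simp: J_def)
  have sub': "complex_vector.subspace (M \<inter> singular_space T m)"
    by (intro complex_vector.subspace_inter sub subspace_singular_space)
  moreover have "M \<inter> singular_space T m \<noteq> {0}" using m(1) by (simp add: J_def)
  ultimately obtain x where x: "x \<in> M" "x \<in> singular_space T m" "norm x = 1"
    using nonzero_csubspace_unit_vector by blast
  have Tx: "norm (T x) = m" using norm_T_singular_space[OF x(2) m0] x(3) by simp
  have "min_modulus_on M T = m"
    unfolding min_modulus_on_def
  proof (rule cInf_eq_minimum)
    show "m \<in> {norm (T x) |x. x \<in> M \<and> norm x = 1}" using x Tx by blast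
    fix r assume "r \<in> {norm (T x) |x. x \<in> M \<and> norm x = 1}"
    then obtain y where y: "r = norm (T y)" "y \<in> M" "norm y = 1" by blast
    have "m * norm y \<le> norm (T y)"
      by (rule norm_T_ge_on_closure_span[OF m(2) m0 subsetD[OF MJ y(2)]])
    then show "m \<le> r" by (simp add: y)
  qed
  then show "min_attaining_on M T" unfolding min_attaining_on_def using x Tx by blast
qed

text \<open>On \<open>H\<close>, unitarity makes \<open>cinner (T x) (T z)\<close> equal to a^2
  times \<open>cinner x z\<close>, so T^* T x - a^2 x is orthogonal to \<open>H\<close>. It also
  lies in \<open>H\<close>, which reduces \<open>T\<close>, and hence is 0.\<close>

lemma unitary_polar_part_subset_singular_space:
  assumes H: "reduces H T" and U: "unitary_on H U"
    and TU: "\<And>x. x \<in> H \<Longrightarrow> T x = complex_of_real a *\<^sub>C U x"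
  shows "H \<subseteq> singular_space T a"
proof
  fix x assume x: "x \<in> H"
  have sub: "complex_vector.subspace H" using H closed_csubspaceD by (auto simp: reduces_def)
  have UH: "U x \<in> H" if "x \<in> H" for x
    using U that by (simp add: unitary_on_def bounded_clinear_on_def image_subset_iff)
  obtain V where V: "\<forall>x\<in>H. \<forall>y\<in>H. cinner (U x) y = cinner x (V y)" "\<forall>x\<in>H. V (U x) = x \<and> U (V x) = x"
    using U unfolding unitary_on_def by blast
  define z where "z = cadjoint T (T x) - a\<^sup>2 *\<^sub>R x"
  have z: "z \<in> H"
    unfolding z_def using H x
    by (intro complex_vector.subspace_diff csubspace_scaleR sub) (auto simp: reduces_def)
  have "cinner (T x) (T z) = complex_of_real (a\<^sup>2) * cinner x z"
    using x z by (simp add: TU cinner_simps V UH power2_eq_square)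
  then have "cinner z z = 0"
    by (subst (1) z_def) (simp only: cinner_simps cinner_TT diff_self)
  then show "x \<in> singular_space T a" by (simp add: z_def singular_space_def)
qed

lemma M_r_attained:
  assumes "T \<in> M_r" "reduces M T" "M \<noteq> {0}"
  shows "\<exists>x m. x \<in> M \<and> norm x = 1 \<and> 0 \<le> m \<and> x \<in> singular_space T m \<and>
    (\<forall>y\<in>M. norm y = 1 \<longrightarrow> m \<le> norm (T y))"
proof -
  obtain x where x: "x \<in> M" "norm x = 1" "norm (T x) = min_modulus_on M T"
    using assms by (auto simp: M_r_def min_attaining_on_def)
  show ?thesis
    using min_modulus_attained_singular[OF assms(2) x] min_modulus_on_le[of _ M] x norm_ge_zero[of "T x"]
    by (intro exI[of _ x] exI[of _ "norm (T x)"]) (simp del: norm_ge_zero)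
qed

text \<open>A singular vector in the complement \<open>?N\<close> would also lie in
  \<open>?W\<close> and be orthogonal to itself. That \<open>?W\<close> reduces \<open>T\<close> is
  assumed here and supplied later by normality.\<close>

lemma M_r_singular_spaces_total:
  assumes "T \<in> M_r" and red: "reduces (closure (complex_vector.span (\<Union>a\<in>{0..}. singular_space T a))) T"
  shows "closure (complex_vector.span (\<Union>a\<in>{0..}. singular_space T a)) = UNIV" (is "?W = UNIV")
proof -
  let ?N = "{x. \<forall>y\<in>?W. cinner x y = 0}"
  have "?N = {0}"
  proof (rule ccontr)
    assume "?N \<noteq> {0}"
    from M_r_attained[OF assms(1) reduces_orthogonal[OF T red] this]
    obtain x m where x: "x \<in> ?N" "norm x = 1" "0 \<le> m" "x \<in> singular_space T m" by blast
    then have "x \<in> ?W" using subset_closure_span by fastforce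
    then have "cinner x x = 0" using x(1) by blast
    then show False using x(2) by auto
  qed
  then have "UNIV \<subseteq> ?W"
  proof (intro total_subset_closure_span)
    fix z :: 'a assume "\<And>x. x \<in> (\<Union>a\<in>{0..}. singular_space T a) \<Longrightarrow> cinner z x = 0"
    then have "z \<in> ?N" using orthogonal_closure_span by blast
    then show "z = 0" using \<open>?N = {0}\<close> by blast
  qed (auto simp: closed_csubspace_def)
  then show ?thesis by blast
qed

end

section \<open>Normal operators and their singular spaces\<close>

locale normal_operator = bounded_operator +
  assumes normal: "T (cadjoint T x) = cadjoint T (T x)"
begin

text \<open>By normality \<open>T\<close> and \<open>cadjoint T\<close> both commute with T^* T, so
  they preserve its eigenspaces.\<close>

lemma singular_space_invariant:
  assumes "x \<in> singular_space T a"
  shows "T x \<in> singular_space T a" "cadjoint T x \<in> singular_space T a"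
  using assms by (simp_all add: singular_space_def normal T.scaleR T'.scaleR flip: normal[of "T x"])

lemma reduces_singular_space: "reduces (singular_space T a) T"
  using singular_space_invariant closed_csubspace_singular_space by (auto simp: reduces_def)

lemma reduces_closure_span_singular_spaces:
  "reduces (closure (complex_vector.span (\<Union>a\<in>I. singular_space T a))) T"
  using singular_space_invariant by (intro reduces_closure_span T) auto

lemma M_r_least_singular_value:
  assumes "T \<in> M_r" and S: "S \<noteq> {}" "\<And>a. a \<in> S \<Longrightarrow> 0 \<le> a \<and> singular_space T a \<noteq> {0}"
  shows "\<exists>m\<in>S. \<forall>a\<in>S. m \<le> a"
proof -
  let ?W = "closure (complex_vector.span (\<Union>a\<in>S. singular_space T a))"
  have unit: "\<exists>y. y \<in> singular_space T a \<and> y \<in> ?W \<and> norm y = 1" if "a \<in> S" for a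
    using S(2)[OF that] that nonzero_csubspace_unit_vector[OF subspace_singular_space[of a]]
      subset_closure_span[of "\<Union>a\<in>S. singular_space T a"]
    by blast
  then have "?W \<noteq> {0}" using S(1) by force
  from M_r_attained[OF assms(1) reduces_closure_span_singular_spaces this]
  obtain x m where x: "x \<in> ?W" "norm x = 1" "0 \<le> m" "x \<in> singular_space T m"
      and least: "\<forall>y\<in>?W. norm y = 1 \<longrightarrow> m \<le> norm (T y)" by blast
  \<comment> \<open>Otherwise \<open>x\<close> would be orthogonal to all spaces spanning
    \<open>?W\<close>, hence to itself.\<close>
  have "m \<in> S"
  proof (rule ccontr)
    assume "m \<notin> S"
    then have "cinner x y = 0" if "y \<in> (\<Union>a\<in>S. singular_space T a)" for y
      using that S(2) x singular_space_orthogonal by (metis UN_E)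
    then have "cinner x x = 0" using x(1) by (rule orthogonal_closure_span)
    then show False using x(2) by auto
  qed
  moreover have "m \<le> a" if "a \<in> S" for a
  proof -
    obtain y where "y \<in> singular_space T a" "y \<in> ?W" "norm y = 1" using unit[OF \<open>a \<in> S\<close>] by blast
    then show ?thesis using least norm_T_singular_space[of y a] S(2)[OF that] by force
  qed
  ultimately show ?thesis by blast
qed

lemma unitary_on_singular_space:
  assumes "0 \<le> a"
  shows "\<exists>U. unitary_on (singular_space T a) U \<and>
    (\<forall>x\<in>singular_space T a. T x = complex_of_real a *\<^sub>C U x)"
proof (cases "a = 0")
  case True
  \<comment> \<open>For \<open>a = 0\<close> the operator vanishes on the singular space, and the
    identity serves as \<open>U\<close>.\<close>
  have "T x = 0" if "x \<in> singular_space T a" for x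
    using norm_T_singular_space[OF that assms] True by simp
  moreover have "unitary_on (singular_space T a) (\<lambda>x. x)"
    unfolding unitary_on_def bounded_clinear_on_def
    by (intro conjI exI[of _ "\<lambda>x. x"] exI[of _ 1]) auto
  ultimately show ?thesis using True by (intro exI[of _ "\<lambda>x. x"]) auto
next
  case False
  let ?E = "singular_space T a"
  \<comment> \<open>Both products of \<open>T\<close> and \<open>cadjoint T\<close> act on
    \<open>?E\<close> as multiplication by a^2, so these two maps are inverse as well as adjoint to
    each other.\<close>
  define U V where "U x = inverse a *\<^sub>R T x" and "V x = inverse a *\<^sub>R cadjoint T x" for x
  have U: "bounded_clinear_on ?E U"
    unfolding bounded_clinear_on_def U_def
  proof (intro conjI)
    show "\<exists>K. \<forall>x\<in>?E. norm (inverse a *\<^sub>R T x) \<le> K * norm x"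
      using norm_T_singular_space[OF _ assms] assms False by (intro exI[of _ 1]) (simp add: field_simps)
  qed (auto simp: T.add scaleR_add_right T_scaleC scaleR_scaleC_commute
      intro!: csubspace_scaleR subspace_singular_space singular_space_invariant)
  obtain K where K: "\<And>x. norm (cadjoint T x) \<le> norm x * K" using T'.bounded by blast
  have V: "bounded_clinear_on ?E V"
    unfolding bounded_clinear_on_def V_def
  proof (intro conjI)
    show "\<exists>K. \<forall>x\<in>?E. norm (inverse a *\<^sub>R cadjoint T x) \<le> K * norm x"
      using K mult_left_mono[OF K, of "\<bar>inverse a\<bar>"]
      by (intro exI[of _ "\<bar>inverse a\<bar> * K"]) (auto simp: mult_ac)
  qed (auto simp: T'.add scaleR_add_right T'_scaleC scaleR_scaleC_commute
      intro!: csubspace_scaleR subspace_singular_space singular_space_invariant)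
  have "V (U x) = x \<and> U (V x) = x" if "x \<in> ?E" for x
    using that False
    by (simp add: U_def V_def T.scaleR T'.scaleR normal singular_space_def power2_eq_square field_simps)
  moreover have "cinner (U x) y = cinner x (V y)" for x y
    by (simp add: U_def V_def cinner_simps cinner_cadjoint[OF T])
  moreover have "T x = complex_of_real a *\<^sub>C U x" for x
    using False by (simp add: U_def flip: scaleR_scaleC)
  ultimately show ?thesis using U V unfolding unitary_on_def by blast
qed

end

section \<open>Equivalence of membership in \<open>M_r\<close> with the well-ordered
  decomposition\<close>

theorem theorem6p7:
  fixes T :: "'h::chilbert_space \<Rightarrow> 'h"
    and \<Lambda> :: "real set"
  assumes "infinite_dimensional TYPE('h)"
    and "separable TYPE('h)"
    and "normal_op T"
    and "\<Lambda> = {a. complex_of_real a \<in> point_spectrum (abs_op T)}"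
  shows "point_spectrum (abs_op T) \<subseteq> complex_of_real ` {0..onorm T} \<and>
    (T \<in> M_r \<longleftrightarrow>
      countable \<Lambda> \<and>
      well_order_on \<Lambda> {(x, y). x \<in> \<Lambda> \<and> y \<in> \<Lambda> \<and> x \<le> y} \<and>
      (\<exists>(H :: real \<Rightarrow> 'h set) (U :: real \<Rightarrow> 'h \<Rightarrow> 'h).
         orthogonal_direct_sum \<Lambda> H \<and>
         (\<forall>a\<in>\<Lambda>. reduces (H a) T \<and> unitary_on (H a) (U a) \<and>
                (\<forall>x\<in>H a. T x = complex_of_real a *\<^sub>C U a x))))"
    (is "?spec \<and> (_ \<longleftrightarrow> _ \<and> _ \<and> ?dec)")
proof
  interpret normal_operator T
    using assms(3) by unfold_locales (auto simp: normal_op_def fun_eq_iff)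
  have \<Lambda>: "\<Lambda> = {a. 0 \<le> a \<and> singular_space T a \<noteq> {0}}"
    by (auto simp: assms(4) point_spectrum_abs_op_iff)
  show ?spec
  proof
    fix c assume "c \<in> point_spectrum (abs_op T)"
    then obtain a where "0 \<le> a" "c = complex_of_real a" "singular_space T a \<noteq> {0}"
      by (auto simp only: point_spectrum_abs_op_iff)
    then show "c \<in> complex_of_real ` {0..onorm T}"
      using singular_value_le_onorm by simp
  qed
  show "T \<in> M_r \<longleftrightarrow> countable \<Lambda> \<and>
      well_order_on \<Lambda> {(x, y). x \<in> \<Lambda> \<and> y \<in> \<Lambda> \<and> x \<le> y} \<and> ?dec"
    unfolding well_order_on_real_iff
  proof (intro iffI conjI)
    assume Mr: "T \<in> M_r"
    show "countable \<Lambda>"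
    proof (rule countable_orthogonal_family[OF assms(2), where E = "singular_space T"])
      show "\<exists>x\<in>singular_space T a. norm x = 1" if "a \<in> \<Lambda>" for a
        using that nonzero_csubspace_unit_vector[OF subspace_singular_space[of a]]
        unfolding \<Lambda> by blast
    qed (auto simp: \<Lambda> intro: singular_space_orthogonal)
    show "\<forall>S. S \<subseteq> \<Lambda> \<and> S \<noteq> {} \<longrightarrow> (\<exists>m\<in>S. \<forall>a\<in>S. m \<le> a)"
      using M_r_least_singular_value[OF Mr] by (auto simp: \<Lambda> subset_iff)
    obtain U where U: "\<And>a. a \<in> \<Lambda> \<Longrightarrow> unitary_on (singular_space T a) (U a) \<and>
        (\<forall>x\<in>singular_space T a. T x = complex_of_real a *\<^sub>C U a x)"
      using unitary_on_singular_space unfolding \<Lambda> by (metis (mono_tags, lifting) mem_Collect_eq)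
    \<comment> \<open>Passing from all nonnegative indices to \<open>\<Lambda>\<close> discards only
      spaces equal to \<open>{0}\<close>.\<close>
    have "(\<Union>a\<in>{0..}. singular_space T a) \<subseteq> closure (complex_vector.span (\<Union>a\<in>\<Lambda>. singular_space T a))"
    proof
      fix x assume "x \<in> (\<Union>a\<in>{0..}. singular_space T a)"
      then have "x = 0 \<or> x \<in> (\<Union>a\<in>\<Lambda>. singular_space T a)" unfolding \<Lambda> by auto
      then show "x \<in> closure (complex_vector.span (\<Union>a\<in>\<Lambda>. singular_space T a))"
        using subset_closure_span[of "\<Union>a\<in>\<Lambda>. singular_space T a"]
          complex_vector.subspace_0[OF closed_csubspaceD(1)[OF closed_csubspace_closure_span]]
        by blast
    qed
    then have "closure (complex_vector.span (\<Union>a\<in>\<Lambda>. singular_space T a)) = UNIV"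
      using closure_span_minimal[OF closed_csubspace_closure_span]
        M_r_singular_spaces_total[OF Mr reduces_closure_span_singular_spaces] by blast
    then have "orthogonal_direct_sum \<Lambda> (singular_space T)"
      unfolding orthogonal_direct_sum_def
      using closed_csubspace_singular_space singular_space_orthogonal by (auto simp: \<Lambda>)
    then show ?dec using U reduces_singular_space by blast
  next
    assume R: "countable \<Lambda> \<and> (\<forall>S. S \<subseteq> \<Lambda> \<and> S \<noteq> {} \<longrightarrow> (\<exists>m\<in>S. \<forall>a\<in>S. m \<le> a)) \<and> ?dec"
    then obtain H U where H: "orthogonal_direct_sum \<Lambda> H"
        "\<And>a. a \<in> \<Lambda> \<Longrightarrow> reduces (H a) T" "\<And>a. a \<in> \<Lambda> \<Longrightarrow> unitary_on (H a) (U a)"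
        "\<And>a x. a \<in> \<Lambda> \<Longrightarrow> x \<in> H a \<Longrightarrow> T x = complex_of_real a *\<^sub>C U a x" by blast
    \<comment> \<open>The given decomposition is arbitrary, but each part sits inside the singular
      space of its index, so the singular spaces over \<open>\<Lambda>\<close> have dense span as
      well.\<close>
    have "H a \<subseteq> singular_space T a" if "a \<in> \<Lambda>" for a
      by (rule unitary_polar_part_subset_singular_space[OF H(2-4)[OF that]])
    then have "(\<Union>a\<in>\<Lambda>. H a) \<subseteq> (\<Union>a\<in>\<Lambda>. singular_space T a)" by blast
    then have "closure (complex_vector.span (\<Union>a\<in>\<Lambda>. H a)) \<subseteq> closure (complex_vector.span (\<Union>a\<in>\<Lambda>. singular_space T a))"
      by (intro closure_mono complex_vector.span_mono)
    then have "closure (complex_vector.span (\<Union>a\<in>\<Lambda>. singular_space T a)) = UNIV"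
      using H(1) by (auto simp: orthogonal_direct_sum_def)
    then show "T \<in> M_r"
      using R by (intro M_r_if_singular_spaces_total[of \<Lambda>]) (auto simp: \<Lambda>)
  qed
qed

end
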